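(* Let $(X,d)$ be a compact metric space, let $f:X\to X$ be a continuous map such that $(X,d,f)$ satisfies the almost weak specification property, and let $\varphi:X\to\mathbb{R}$ be continuous. Let $I_\varphi$ be the set of $x\in X$ for which $\lim_{n\to\infty}\frac1n\sum_{i=0}^{n-1}\varphi(f^i(x))$ does not exist. (a) If $\overline{\mathrm{mdim}}_{\mathrm M}(X,f,d)<\infty$, then either $I_\varphi=\emptyset$ or $\overline{\mathrm{mdim}}_{\mathrm M}^B(I_\varphi,f,d)=\overline{\mathrm{mdim}}_{\mathrm M}(X,f,d)$. (b) If $\underline{\mathrm{mdim}}_{\mathrm M}(X,f,d)<\infty$, then either $I_\varphi=\emptyset$ or $\underline{\mathrm{mdim}}_{\mathrm M}^B(I_\varphi,f,d)=\underline{\mathrm{mdim}}_{\mathrm M}(X,f,d)$.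
   Context: Almost weak specification property: for every $\epsilon>0$ there is a function $L_\epsilon:\mathbb{N}\to\mathbb{N}$ that is tempered (nondecreasing with $\lim_{n\to\infty}L_\epsilon(n)/n=0$) such that for any points $x_1,\dots,x_k\in X$ and positive integers $a_1\le b_1<a_2\le b_2<\dots<a_k\le b_k$ with $a_{j+1}-b_j\ge L_\epsilon(b_{j+1}-a_{j+1})$ for all $j\in\{1,\dots,k-1\}$, there is $y\in X$ with $d(f^i(y),f^{i-a_j}(x_j))<\epsilon$ for all $i\in[a_j,b_j]$ and $j\in\{1,\dots,k\}$. Bowen metric and balls: $d_n(x,y)=\max_{0\le i\le n-1}d(f^ix,f^iy)$ and $B_n(x,\epsilon)=\{y\in X:d_n(x,y)<\epsilon\}$. Bowen metric mean dimension: for nonempty $Z\subset X$, $s\in\mathbb{R}$, $N\in\mathbb{N}$, $\epsilon>0$, let $m(Z,s,N,\epsilon)=\inf_\Gamma\sum_{i\in I}\exp(-sn_i)$, the infimum being over all finite or countable collections $\Gamma=\{B_{n_i}(x_i,\epsilon)\}_{i\in I}$ with $Z\subset\bigcup_{i\in I}B_{n_i}(x_i,\epsilon)$ and $\min_i n_i\ge N$. Let $m(Z,s,\epsilon)=\lim_{N\to\infty}m(Z,s,N,\epsilon)$, and let $h^B_{top}(Z,f,\epsilon)$ be the critical value of $s$ such that $m(Z,s,\epsilon)=+\infty$ for $s<h^B_{top}(Z,f,\epsilon)$ and $m(Z,s,\epsilon)=0$ for $s>h^B_{top}(Z,f,\epsilon)$. The Bowen upper and lower metric mean dimensions of $f$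 on $Z$ are $$\overline{\mathrm{mdim}}_{\mathrm M}^B(Z,f,d)=\limsup_{\epsilon\to0}\frac{h^B_{top}(Z,f,\epsilon)}{|\log\epsilon|},\qquad \underline{\mathrm{mdim}}_{\mathrm M}^B(Z,f,d)=\liminf_{\epsilon\to0}\frac{h^B_{top}(Z,f,\epsilon)}{|\log\epsilon|}.$$ Classical metric mean dimension: a set $E\subset X$ is $(n,\epsilon)$-separated if $d_n(x,y)>\epsilon$ for all $x\neq y$ in $E$; $s(f,X,n,\epsilon)$ is the largest cardinality of an $(n,\epsilon)$-separated subset of $X$; $h_{top}(f,X,\epsilon)=\limsup_{n\to\infty}\frac1n\log s(f,X,n,\epsilon)$; and $$\overline{\mathrm{mdim}}_{\mathrm M}(X,f,d)=\limsup_{\epsilon\to0}\frac{h_{top}(f,X,\epsilon)}{|\log\epsilon|},\qquad \underline{\mathrm{mdim}}_{\mathrm M}(X,f,d)=\liminf_{\epsilon\to0}\frac{h_{top}(f,X,\epsilon)}{|\log\epsilon|}.$$ *)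

theory Defs
  imports "HOL-Analysis.Analysis"
begin

text \<open>
  The compact metric space is a type of class \<open>metric_space\<close> whose universe is compact, so that
  \<open>dist\<close> is the metric \<open>d\<close>. All dimension-like quantities take values in \<open>ereal\<close>.
\<close>

subsection \<open>Almost weak specification\<close>

definition tempered :: "(nat \<Rightarrow> nat) \<Rightarrow> bool" where
  "tempered L \<longleftrightarrow> mono L \<and> (\<lambda>n. real (L n) / real n) \<longlonglongrightarrow> 0"

definition almost_weak_specification :: "('a::metric_space \<Rightarrow> 'a) \<Rightarrow> bool" where
  "almost_weak_specification f \<longleftrightarrow>
    (\<forall>\<epsilon>>0. \<exists>L. tempered L \<and>
      (\<forall>k\<ge>1. \<forall>(x :: nat \<Rightarrow> 'a) (a :: nat \<Rightarrow> nat) (b :: nat \<Rightarrow> nat).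
        (\<forall>j\<in>{1..k}. 0 < a j \<and> a j \<le> b j) \<and>
        (\<forall>j\<in>{1..<k}. b j < a (j + 1) \<and> L (b (j + 1) - a (j + 1)) \<le> a (j + 1) - b j) \<longrightarrow>
        (\<exists>y. \<forall>j\<in>{1..k}. \<forall>i\<in>{a j..b j}. dist ((f ^^ i) y) ((f ^^ (i - a j)) (x j)) < \<epsilon>)))"


subsection \<open>Bowen metrics and balls\<close>

text \<open>Meaningful for \<open>n \<ge> 1\<close> only, since \<open>Max {}\<close> is unspecified.\<close>

definition bowen_dist :: "('a::metric_space \<Rightarrow> 'a) \<Rightarrow> nat \<Rightarrow> 'a \<Rightarrow> 'a \<Rightarrow> real" where
  "bowen_dist f n x y = (MAX i\<in>{0..<n}. dist ((f ^^ i) x) ((f ^^ i) y))"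

definition bowen_ball :: "('a::metric_space \<Rightarrow> 'a) \<Rightarrow> nat \<Rightarrow> 'a \<Rightarrow> real \<Rightarrow> 'a set" where
  "bowen_ball f n x \<epsilon> = {y. bowen_dist f n x y < \<epsilon>}"


subsection \<open>Bowen metric mean dimension of a subset\<close>

text \<open>
  A finite or countable collection of Bowen balls is a family indexed by some \<open>I \<subseteq> \<nat>\<close>.
  The requirement \<open>1 \<le> n i\<close> only matters for \<open>N = 0\<close>.
\<close>

definition bowen_cover ::
    "('a::metric_space \<Rightarrow> 'a) \<Rightarrow> 'a set \<Rightarrow> nat \<Rightarrow> real \<Rightarrow> nat set \<Rightarrow> (nat \<Rightarrow> nat) \<Rightarrow> (nat \<Rightarrow> 'a) \<Rightarrow> bool" where
  "bowen_cover f Z N \<epsilon> I n x \<longleftrightarrow>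
    Z \<subseteq> (\<Union>i\<in>I. bowen_ball f (n i) (x i) \<epsilon>) \<and> (\<forall>i\<in>I. 1 \<le> n i \<and> N \<le> n i)"

definition bowen_premeasure ::
    "('a::metric_space \<Rightarrow> 'a) \<Rightarrow> 'a set \<Rightarrow> real \<Rightarrow> nat \<Rightarrow> real \<Rightarrow> ennreal" where
  "bowen_premeasure f Z s N \<epsilon> =
    Inf {(\<Sum>\<^sub>\<infinity>i\<in>I. ennreal (exp (- s * real (n i)))) | I n x. bowen_cover f Z N \<epsilon> I n x}"

definition bowen_measure :: "('a::metric_space \<Rightarrow> 'a) \<Rightarrow> 'a set \<Rightarrow> real \<Rightarrow> real \<Rightarrow> ennreal" where
  "bowen_measure f Z s \<epsilon> = lim (\<lambda>N. bowen_premeasure f Z s N \<epsilon>)"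

definition is_critical_value :: "(real \<Rightarrow> ennreal) \<Rightarrow> ereal \<Rightarrow> bool" where
  "is_critical_value m h \<longleftrightarrow>
    (\<forall>s. ereal s < h \<longrightarrow> m s = \<infinity>) \<and> (\<forall>s. h < ereal s \<longrightarrow> m s = 0)"

definition bowen_entropy :: "('a::metric_space \<Rightarrow> 'a) \<Rightarrow> 'a set \<Rightarrow> real \<Rightarrow> ereal" where
  "bowen_entropy f Z \<epsilon> = (THE h. is_critical_value (\<lambda>s. bowen_measure f Z s \<epsilon>) h)"

definition upper_bowen_mdim :: "('a::metric_space \<Rightarrow> 'a) \<Rightarrow> 'a set \<Rightarrow> ereal" where
  "upper_bowen_mdim f Z = Limsup (at_right 0) (\<lambda>\<epsilon>. bowen_entropy f Z \<epsilon> / ereal \<bar>ln \<epsilon>\<bar>)"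

definition lower_bowen_mdim :: "('a::metric_space \<Rightarrow> 'a) \<Rightarrow> 'a set \<Rightarrow> ereal" where
  "lower_bowen_mdim f Z = Liminf (at_right 0) (\<lambda>\<epsilon>. bowen_entropy f Z \<epsilon> / ereal \<bar>ln \<epsilon>\<bar>)"

text \<open>The limit and the critical value in these definitions always exist, the latter uniquely.\<close>

lemma incseq_bowen_premeasure: "incseq (\<lambda>N. bowen_premeasure f Z s N \<epsilon>)"
  unfolding incseq_def bowen_premeasure_def bowen_cover_def
  by (intro allI impI Inf_superset_mono) force

lemma bowen_measure_eq_SUP: "bowen_measure f Z s \<epsilon> = (SUP N. bowen_premeasure f Z s N \<epsilon>)"
  unfolding bowen_measure_def by (intro limI LIMSEQ_SUP incseq_bowen_premeasure)

lemma bowen_premeasure_decay: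
  assumes "s \<le> t"
  shows "bowen_premeasure f Z t N \<epsilon> \<le> ennreal (exp (- (t - s) * real N)) * bowen_premeasure f Z s N \<epsilon>"
proof -
  let ?c = "ennreal (exp (- (t - s) * real N))"
  let ?S = "{(\<Sum>\<^sub>\<infinity>i\<in>I. ennreal (exp (- s * real (n i)))) | I n x. bowen_cover f Z N \<epsilon> I n x}"
  have c: "?c \<noteq> 0" "?c \<noteq> top" by (simp_all add: ennreal_eq_0_iff)
  have le: "bowen_premeasure f Z t N \<epsilon> \<le> ?c * (\<Sum>\<^sub>\<infinity>i\<in>I. ennreal (exp (- s * real (n i))))"
    if cov: "bowen_cover f Z N \<epsilon> I n x" for I n x
  proof -
    have "bowen_premeasure f Z t N \<epsilon> \<le> (\<Sum>\<^sub>\<infinity>i\<in>I. ennreal (exp (- t * real (n i))))"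
      unfolding bowen_premeasure_def using cov by (intro Inf_lower) blast
    also have "\<dots> \<le> (\<Sum>\<^sub>\<infinity>i\<in>I. ?c * ennreal (exp (- s * real (n i))))"
    proof (rule infsum_mono)
      fix i assume "i \<in> I"
      then have "real N \<le> real (n i)" using cov by (auto simp: bowen_cover_def)
      then have "(t - s) * real N \<le> (t - s) * real (n i)"
        using assms by (intro mult_left_mono) auto
      then have "exp (- t * real (n i)) \<le> exp (- (t - s) * real N) * exp (- s * real (n i))"
        by (simp add: algebra_simps flip: exp_add)
      then show "ennreal (exp (- t * real (n i))) \<le> ?c * ennreal (exp (- s * real (n i)))"
        by (simp flip: ennreal_mult add: ennreal_leI)
    qed (auto intro: nonneg_summable_on_complete)
    also have "\<dots> = ?c * (\<Sum>\<^sub>\<infinity>i\<in>I. ennreal (exp (- s * real (n i))))"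
      by (simp add: nonneg_infsum_complete SUP_mult_left_ennreal flip: sum_distrib_left)
    finally show ?thesis .
  qed
  have "bowen_premeasure f Z t N \<epsilon> / ?c \<le> Inf ?S"
  proof (rule Inf_greatest)
    fix v assume "v \<in> ?S"
    then have "bowen_premeasure f Z t N \<epsilon> \<le> v * ?c" using le by (auto simp: mult.commute)
    then show "bowen_premeasure f Z t N \<epsilon> / ?c \<le> v"
      using c by (intro divide_le_posI_ennreal) (auto simp: mult.commute zero_less_iff_neq_zero)
  qed
  then have "bowen_premeasure f Z t N \<epsilon> / ?c * ?c \<le> Inf ?S * ?c"
    by (intro mult_right_mono) auto
  moreover have "a / ?c * ?c = a" for a
    using c by (simp add: ennreal_divide_times)
  moreover have "Inf ?S = bowen_premeasure f Z s N \<epsilon>"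
    by (simp add: bowen_premeasure_def)
  ultimately show ?thesis by (simp only: mult.commute)
qed

lemma ex1_critical_value_bowen_measure:
  "\<exists>!h. is_critical_value (\<lambda>s. bowen_measure f Z s \<epsilon>) h"
proof -
  let ?m = "\<lambda>s. bowen_measure f Z s \<epsilon>"
  have drop: "?m t = 0" if "s < t" "?m s \<noteq> \<infinity>" for s t
  proof -
    have "(\<lambda>N. exp (- (t - s) * real N)) \<longlonglongrightarrow> 0"
    proof -
      have "(\<lambda>N. exp (- (t - s)) ^ N) \<longlonglongrightarrow> 0"
        using that by (intro LIMSEQ_realpow_zero) auto
      then show ?thesis by (simp add: exp_of_nat2_mult)
    qed
    then have "(\<lambda>N. ennreal (exp (- (t - s) * real N))) \<longlonglongrightarrow> 0"
      using tendsto_ennrealI by fastforce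
    then have "(\<lambda>N. ?m s * ennreal (exp (- (t - s) * real N))) \<longlonglongrightarrow> ?m s * 0"
      using that by (intro ennreal_tendsto_cmult) (auto simp: less_top)
    then have "(\<lambda>N. ennreal (exp (- (t - s) * real N)) * ?m s) \<longlonglongrightarrow> 0"
      by (simp add: mult.commute)
    moreover have "(\<lambda>N. bowen_premeasure f Z t N \<epsilon>) \<longlonglongrightarrow> ?m t"
      unfolding bowen_measure_eq_SUP by (intro LIMSEQ_SUP incseq_bowen_premeasure)
    moreover have "bowen_premeasure f Z t N \<epsilon> \<le> ennreal (exp (- (t - s) * real N)) * ?m s" for N
    proof -
      have "bowen_premeasure f Z s N \<epsilon> \<le> ?m s"
        unfolding bowen_measure_eq_SUP by (rule SUP_upper) simp
      then show ?thesis
        using bowen_premeasure_decay[of s t f Z N \<epsilon>] that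
        by (meson less_imp_le mult_left_mono order_trans zero_le)
    qed
    ultimately have "?m t \<le> 0" by (intro LIMSEQ_le) auto
    then show ?thesis by simp
  qed
  have "is_critical_value ?m (Inf (ereal ` {s. ?m s \<noteq> \<infinity>}))"
    unfolding is_critical_value_def
  proof (intro conjI allI impI)
    fix s assume "ereal s < Inf (ereal ` {s. ?m s \<noteq> \<infinity>})"
    then show "?m s = \<infinity>" by (metis (mono_tags, lifting) Inf_lower image_eqI leD mem_Collect_eq)
  next
    fix s assume "Inf (ereal ` {s. ?m s \<noteq> \<infinity>}) < ereal s"
    then show "?m s = 0" using drop by (auto simp: Inf_less_iff)
  qed
  moreover have "h = h'" if "is_critical_value ?m h" "is_critical_value ?m h'" for h h'
  proof -
    have "\<not> h < h'" if "is_critical_value ?m h" "is_critical_value ?m h'" for h h'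
    proof
      assume "h < h'"
      then obtain r where "h < ereal r" "ereal r < h'" using ereal_dense2 by blast
      then have "?m r = 0" "?m r = \<infinity>" using that by (auto simp: is_critical_value_def)
      then show False by simp
    qed
    then show ?thesis using that by (metis linorder_neqE)
  qed
  ultimately show ?thesis by blast
qed


subsection \<open>Classical metric mean dimension\<close>

definition bowen_separated :: "('a::metric_space \<Rightarrow> 'a) \<Rightarrow> nat \<Rightarrow> real \<Rightarrow> 'a set \<Rightarrow> bool" where
  "bowen_separated f n \<epsilon> E \<longleftrightarrow> (\<forall>x\<in>E. \<forall>y\<in>E. x \<noteq> y \<longrightarrow> bowen_dist f n x y > \<epsilon>)"

text \<open>
  The maximum exists for \<open>n \<ge> 1\<close>, \<open>\<epsilon> > 0\<close>, compact nonempty \<open>X\<close> and continuous \<open>f\<close>; separated sets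
  are then automatically finite.
\<close>

definition max_separated_card :: "('a::metric_space \<Rightarrow> 'a) \<Rightarrow> 'a set \<Rightarrow> nat \<Rightarrow> real \<Rightarrow> nat" where
  "max_separated_card f X n \<epsilon> = Max {card E | E. E \<subseteq> X \<and> finite E \<and> bowen_separated f n \<epsilon> E}"

definition scale_entropy :: "('a::metric_space \<Rightarrow> 'a) \<Rightarrow> 'a set \<Rightarrow> real \<Rightarrow> ereal" where
  "scale_entropy f X \<epsilon> = limsup (\<lambda>n. ereal (1 / real n * ln (real (max_separated_card f X n \<epsilon>))))"

definition upper_mdim :: "('a::metric_space \<Rightarrow> 'a) \<Rightarrow> 'a set \<Rightarrow> ereal" where
  "upper_mdim f X = Limsup (at_right 0) (\<lambda>\<epsilon>. scale_entropy f X \<epsilon> / ereal \<bar>ln \<epsilon>\<bar>)"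

definition lower_mdim :: "('a::metric_space \<Rightarrow> 'a) \<Rightarrow> 'a set \<Rightarrow> ereal" where
  "lower_mdim f X = Liminf (at_right 0) (\<lambda>\<epsilon>. scale_entropy f X \<epsilon> / ereal \<bar>ln \<epsilon>\<bar>)"


subsection \<open>The irregular set\<close>

definition irregular_set :: "('a::metric_space \<Rightarrow> 'a) \<Rightarrow> ('a \<Rightarrow> real) \<Rightarrow> 'a set" where
  "irregular_set f \<phi> =
    {x. \<not> convergent (\<lambda>n. 1 / real n * (\<Sum>i = 0..<n. \<phi> ((f ^^ i) x)))}"

end

theory Submission
  imports Defs "HOL-Probability.Infinite_Product_Measure" "HOL-Library.Discrete_Functions"
begin

text \<open>
  Write \<open>F \<epsilon>\<close> for the entropy of \<open>f\<close> at scale \<open>\<epsilon>\<close> and \<open>H \<epsilon>\<close> for the Bowen entropy of the irregular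
  set at scale \<open>\<epsilon>\<close>. Covering by balls around a maximal separated set gives \<open>H (2 \<epsilon>) \<le> F \<epsilon>\<close>. If the
  irregular set is nonempty, then also \<open>F (3 \<epsilon>) \<le> H \<epsilon>\<close>; since a constant factor in \<open>\<epsilon>\<close> does not matter
  after division by \<open>\<bar>ln \<epsilon>\<bar>\<close>, the two inequalities give both equalities of dimensions.

  For \<open>F (3 \<epsilon>) \<le> H \<epsilon>\<close>, fix a large \<open>n\<close> and a separated set of orbit segments of length \<open>n\<close>, thinned out by
  the pigeonhole principle so that their averages of \<open>\<phi>\<close> nearly agree. Almost weak specification
  provides points shadowing arbitrary sequences of such segments, with gaps that are short compared to
  \<open>n\<close>, where additionally every \<open>q\<close>-th segment is replaced by a fixed one with a low or with a high average.
  Switching between low and high at the times \<open>2\<^sup>i\<close> makes the Birkhoff averages diverge, while only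
  the fraction \<open>1 / q\<close> of the entropy is lost. The fixed segments exist for every \<open>n\<close> as soon as there
  is one irregular point. The lower bound for sums over covers comes from the product measure on the
  sequences of segments: a Bowen ball of length \<open>m\<close> determines all segments completed before time \<open>m\<close>.
\<close>

section \<open>Preliminaries: dyadic averages, pigeonhole and covers by cylinders\<close>

text \<open>
  If the averages \<open>A\<close> tend to \<open>l\<close>, then so do the averages over \<open>[2\<^sup>i, 2\<^sup>i\<^sup>+\<^sup>1)\<close>, being
  \<open>2 A\<^sub>2\<^sub>k - A\<^sub>k\<close> for \<open>k = 2\<^sup>i\<close>.
\<close>

lemma not_convergent_averages_if_dyadic_blocks:
  fixes S :: "nat \<Rightarrow> real"
  assumes "0 < T" "U < V"
    and low: "\<And>i c. even i \<Longrightarrow> 2 ^ i \<le> c \<Longrightarrow> c < 2 ^ Suc i \<Longrightarrow> S (Suc c * T) - S (c * T) \<le> U"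
    and high: "\<And>i c. odd i \<Longrightarrow> 2 ^ i \<le> c \<Longrightarrow> c < 2 ^ Suc i \<Longrightarrow> V \<le> S (Suc c * T) - S (c * T)"
  shows "\<not> convergent (\<lambda>n. 1 / real n * S n)"
proof
  assume "convergent (\<lambda>n. 1 / real n * S n)"
  then obtain l where l: "(\<lambda>n. 1 / real n * S n) \<longlonglongrightarrow> l" by (auto simp: convergent_def)
  define A where "A i = 1 / real (2 ^ i * T) * S (2 ^ i * T)" for i
  \<comment> \<open>\<open>D i\<close> is the mean increment over the cells \<open>c\<close> with
    \<open>2 ^ i \<le> c < 2 ^ Suc i\<close>, hence at most \<open>U\<close> for even
    \<open>i\<close> and at least \<open>V\<close> for odd \<open>i\<close>.\<close>
  define D where "D i = (S (2 ^ Suc i * T) - S (2 ^ i * T)) / 2 ^ i" for i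
  have "strict_mono (\<lambda>i. 2 ^ i * T)"
    using \<open>0 < T\<close> by (simp add: strict_mono_Suc_iff)
  from LIMSEQ_subseq_LIMSEQ[OF l this] have A: "A \<longlonglongrightarrow> l"
    by (simp add: A_def[abs_def] o_def)
  have "D = (\<lambda>i. real T * (2 * A (Suc i) - A i))"
    using \<open>0 < T\<close> by (simp add: fun_eq_iff D_def A_def field_simps)
  moreover have "(\<lambda>i. real T * (2 * A (Suc i) - A i)) \<longlonglongrightarrow> real T * (2 * l - l)"
    by (intro tendsto_intros A LIMSEQ_Suc)
  ultimately have D: "D \<longlonglongrightarrow> real T * l" by simp
  have stretch: "S (2 ^ Suc i * T) - S (2 ^ i * T) = (\<Sum>c = 2 ^ i..<2 ^ Suc i. S (Suc c * T) - S (c * T))" for i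
    using sum_Suc_diff'[of "2 ^ i" "2 ^ Suc i" "\<lambda>c. S (c * T)"] by simp
  have "D (2 * i) \<le> U" for i
  proof -
    have "S (2 ^ Suc (2 * i) * T) - S (2 ^ (2 * i) * T) \<le> real (card {2 ^ (2 * i)..<2 ^ Suc (2 * i) :: nat}) * U"
      unfolding stretch by (intro sum_bounded_above) (auto intro!: low[of "2 * i", simplified])
    then show ?thesis by (simp add: D_def field_simps)
  qed
  moreover have "strict_mono (\<lambda>i::nat. 2 * i)" by (simp add: strict_mono_Suc_iff)
  from LIMSEQ_subseq_LIMSEQ[OF D this] have "(\<lambda>i. D (2 * i)) \<longlonglongrightarrow> real T * l" by (simp add: o_def)
  ultimately have "real T * l \<le> U" by (intro LIMSEQ_le_const2) auto
  have "V \<le> D (Suc (2 * i))" for i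
  proof -
    have "real (card {2 ^ Suc (2 * i)..<2 ^ Suc (Suc (2 * i)) :: nat}) * V
        \<le> S (2 ^ Suc (Suc (2 * i)) * T) - S (2 ^ Suc (2 * i) * T)"
      unfolding stretch by (intro sum_bounded_below) (auto intro!: high[of "Suc (2 * i)", simplified])
    then show ?thesis by (simp add: D_def field_simps)
  qed
  moreover have "strict_mono (\<lambda>i::nat. Suc (2 * i))" by (simp add: strict_mono_Suc_iff)
  from LIMSEQ_subseq_LIMSEQ[OF D this] have "(\<lambda>i. D (Suc (2 * i))) \<longlonglongrightarrow> real T * l" by (simp add: o_def)
  ultimately have "V \<le> real T * l" by (intro LIMSEQ_le_const) auto
  with \<open>real T * l \<le> U\<close> \<open>U < V\<close> show False by simp
qed

text \<open>Cut the range of values into cells of length \<open>\<delta>\<close> and keep the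
  fullest one. The point is that \<open>K\<close> depends on \<open>B\<close> and
  \<open>\<delta>\<close> alone: applied to separated sets of orbit segments of length
  \<open>n\<close>, thinning costs only \<open>ln K / n\<close> of the entropy, which
  vanishes.\<close>

lemma pigeonhole_real_valued:
  fixes B \<delta> :: real
  assumes "0 < \<delta>"
  obtains K :: nat where "1 \<le> K"
    "\<And>(E :: 'b set) v. finite E \<Longrightarrow> (\<And>x. x \<in> E \<Longrightarrow> \<bar>v x\<bar> \<le> B) \<Longrightarrow>
      \<exists>c E'. E' \<subseteq> E \<and> card E \<le> K * card E' \<and> (\<forall>x\<in>E'. c \<le> v x \<and> v x \<le> c + \<delta>)"
proof -
  \<comment> \<open>With \<open>\<bar>B\<bar>\<close> in place of \<open>B\<close> the range of
    cells is nonempty even for negative \<open>B\<close>, whence \<open>1 \<le> K\<close>.\<close>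
  define R where "R = {\<lfloor>- \<bar>B\<bar> / \<delta>\<rfloor>..\<lfloor>\<bar>B\<bar> / \<delta>\<rfloor>}"
  have R: "1 \<le> card R"
  proof -
    have "- \<bar>B\<bar> / \<delta> \<le> \<bar>B\<bar> / \<delta>" using \<open>0 < \<delta>\<close> by (intro divide_right_mono) auto
    then have "\<lfloor>- \<bar>B\<bar> / \<delta>\<rfloor> \<le> \<lfloor>\<bar>B\<bar> / \<delta>\<rfloor>" by (rule floor_mono)
    then show ?thesis unfolding R_def by simp
  qed
  have "\<exists>c E'. E' \<subseteq> E \<and> card E \<le> card R * card E' \<and> (\<forall>x\<in>E'. c \<le> v x \<and> v x \<le> c + \<delta>)"
    if E: "finite E" and v: "\<And>x. x \<in> E \<Longrightarrow> \<bar>v x\<bar> \<le> B" for E :: "'b set" and v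
  proof (rule ccontr)
    assume neg: "\<not> ?thesis"
    define F where "F r = {x\<in>E. \<lfloor>v x / \<delta>\<rfloor> = r}" for r
    have F: "card R * card (F r) < card E" for r
    proof -
      have "of_int r * \<delta> \<le> v x \<and> v x \<le> of_int r * \<delta> + \<delta>" if "x \<in> F r" for x
      proof -
        have "of_int r \<le> v x / \<delta>" "v x / \<delta> \<le> of_int r + 1"
          using that unfolding F_def by (simp_all add: floor_eq_iff)
        then show ?thesis using \<open>0 < \<delta>\<close> by (simp add: field_simps)
      qed
      moreover have "F r \<subseteq> E" by (auto simp: F_def)
      ultimately show ?thesis using neg by (meson not_le)
    qed
    have "(\<Union>r\<in>R. F r) = E"
    proof -
      have "\<lfloor>v x / \<delta>\<rfloor> \<in> R" if "x \<in> E" for x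
      proof -
        have "- \<bar>B\<bar> \<le> v x" "v x \<le> \<bar>B\<bar>" using v[OF that] by auto
        then have "- \<bar>B\<bar> / \<delta> \<le> v x / \<delta>" "v x / \<delta> \<le> \<bar>B\<bar> / \<delta>"
          using \<open>0 < \<delta>\<close> by (intro divide_right_mono; simp)+
        then show ?thesis unfolding R_def by (simp add: floor_mono del: minus_divide_left[symmetric])
      qed
      then show ?thesis by (auto simp: F_def)
    qed
    then have le: "card E \<le> (\<Sum>r\<in>R. card (F r))"
      using card_UN_le[of R F] by (simp add: R_def)
    have "finite R" "R \<noteq> {}" using R by (auto simp: R_def)
    have "(\<Sum>r\<in>R. card R * card (F r)) < (\<Sum>r\<in>R. card E)"
      using \<open>finite R\<close> \<open>R \<noteq> {}\<close> F by (rule sum_strict_mono)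
    then have "card R * (\<Sum>r\<in>R. card (F r)) < card R * card E"
      by (simp add: sum_distrib_left)
    with le have "card R * card E < card R * card E"
      by (meson le_less_trans mult_le_mono2)
    then show False by simp
  qed
  then show ?thesis by (rule that[OF R, rotated]) 
qed

text \<open>Give the sequences over \<open>E\<close> the product of the uniform measures. The
  sequences in \<open>A i\<close> agree on \<open>J i\<close>, so they lie in one cylinder of mass
  \<open>(1 / card E) ^ card (J i)\<close>, and countable subadditivity applies to the total mass
  1.\<close>

lemma sum_cylinder_cover_ge_1:
  fixes A :: "nat \<Rightarrow> (nat \<Rightarrow> 'b) set" and J :: "nat \<Rightarrow> nat set"
  assumes E: "finite E" "E \<noteq> {}"
    and J: "\<And>i. i \<in> I \<Longrightarrow> finite (J i)"
    and agree: "\<And>i \<omega> \<omega>' j. i \<in> I \<Longrightarrow> \<omega> \<in> A i \<Longrightarrow> \<omega>' \<in> A i \<Longrightarrow> j \<in> J i \<Longrightarrow>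
      \<omega> \<in> UNIV \<rightarrow> E \<Longrightarrow> \<omega>' \<in> UNIV \<rightarrow> E \<Longrightarrow> \<omega> j = \<omega>' j"
    and cover: "(UNIV \<rightarrow> E) \<subseteq> (\<Union>i\<in>I. A i)"
  shows "1 \<le> (\<Sum>\<^sub>\<infinity>i\<in>I. ennreal ((1 / real (card E)) ^ card (J i)))"
proof -
  define M where "M = (\<lambda>_::nat. uniform_count_measure E)"
  interpret product_prob_space M UNIV
    unfolding M_def by (rule product_prob_spaceI, rule prob_space_uniform_count_measure[OF E])
  let ?P = "Pi\<^sub>M UNIV M"
  have space: "space ?P = UNIV \<rightarrow> E"
    by (auto simp: space_PiM M_def space_uniform_count_measure PiE_def)
  define a where "a i = (SOME \<omega>. \<omega> \<in> A i \<inter> (UNIV \<rightarrow> E))" for i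
  \<comment> \<open>\<open>A i\<close> may fail to be measurable, so it is replaced by the cylinder
    through a chosen point \<open>a i\<close>. Without such a point, or outside \<open>I\<close>,
    the empty set keeps the family indexed by all naturals.\<close>
  define C where "C i = (if i \<in> I \<and> A i \<inter> (UNIV \<rightarrow> E) \<noteq> {} then {\<omega> \<in> space ?P. \<forall>j\<in>J i. \<omega> j \<in> {a i j}} else {})" for i
  have a: "a i \<in> A i \<inter> (UNIV \<rightarrow> E)" if "A i \<inter> (UNIV \<rightarrow> E) \<noteq> {}" for i
    unfolding a_def using that by (simp only: some_in_eq not_False_eq_True)
  have mC: "emeasure ?P (C i) \<le> (if i \<in> I then ennreal ((1 / real (card E)) ^ card (J i)) else 0)" for i
  proof (cases "i \<in> I \<and> A i \<inter> (UNIV \<rightarrow> E) \<noteq> {}")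
    case True
    then have aE: "a i j \<in> E" for j using a[of i] by (simp add: Pi_iff)
    have Ci: "C i = {\<omega> \<in> space ?P. \<forall>j\<in>J i. \<omega> j \<in> {a i j}}"
      unfolding C_def using True by (rule if_P)
    have "emeasure ?P (C i) = (\<Prod>j\<in>J i. emeasure (M j) {a i j})"
      unfolding Ci using True J aE
      by (intro emeasure_PiM_Collect) (simp_all add: M_def sets_uniform_count_measure)
    also have "\<dots> = (\<Prod>j\<in>J i. ennreal (1 / real (card E)))"
      using aE E
      by (intro prod.cong) (auto simp: M_def emeasure_uniform_count_measure divide_ennreal ennreal_of_nat_eq_real_of_nat)
    also have "\<dots> = ennreal ((1 / real (card E)) ^ card (J i))"
      by (simp add: ennreal_power)
    finally show ?thesis using True by simp
  qed (auto simp: C_def)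
  have sC: "C i \<in> sets ?P" for i
  proof (cases "i \<in> I \<and> A i \<inter> (UNIV \<rightarrow> E) \<noteq> {}")
    case True
    have fin: "finite (J i)" using J True by blast
    have "{\<omega> \<in> space ?P. \<forall>j\<in>J i. \<omega> j \<in> {a i j}} \<in> sets ?P"
    proof (rule sets.sets_Collect_finite_All[OF _ fin])
      fix j assume "j \<in> J i"
      have "(\<lambda>\<omega>. \<omega> j) -` {a i j} \<inter> space ?P \<in> sets ?P"
        using a[of i] True
        by (intro measurable_sets[OF measurable_component_singleton])
          (simp_all add: M_def sets_uniform_count_measure Pi_iff)
      then show "{\<omega> \<in> space ?P. \<omega> j \<in> {a i j}} \<in> sets ?P"
        by (simp add: vimage_def Int_def conj_commute)
    qed
    then show ?thesis unfolding C_def using True by (simp only: if_True simp_thms)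
  qed (auto simp: C_def)
  have "space ?P \<subseteq> (\<Union>i. C i)"
  proof
    fix \<omega> assume \<omega>: "\<omega> \<in> space ?P"
    then obtain i where i: "i \<in> I" "\<omega> \<in> A i" using cover space by blast
    then have ne: "A i \<inter> (UNIV \<rightarrow> E) \<noteq> {}" using \<omega> space by blast
    have "\<omega> j = a i j" if "j \<in> J i" for j
      using agree[OF i(1,2) _ that] a[OF ne] \<omega> space by blast
    then show "\<omega> \<in> (\<Union>i. C i)" using i \<omega> ne by (auto simp: C_def)
  qed
  then have "1 \<le> emeasure ?P (\<Union>i. C i)"
    using emeasure_space_1 emeasure_mono[of "space ?P" "\<Union>i. C i" ?P] sC by auto
  also have "\<dots> \<le> (\<Sum>i. emeasure ?P (C i))"
    using sC by (intro emeasure_subadditive_countably) auto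
  also have "\<dots> \<le> (\<Sum>i. if i \<in> I then ennreal ((1 / real (card E)) ^ card (J i)) else 0)"
    by (intro suminf_le mC summableI)
  also have "\<dots> = (\<Sum>\<^sub>\<infinity>i. if i \<in> I then ennreal ((1 / real (card E)) ^ card (J i)) else 0)"
    by (intro sums_unique[symmetric] has_sum_imp_sums has_sum_infsum nonneg_summable_on_complete) auto
  also have "\<dots> = (\<Sum>\<^sub>\<infinity>i\<in>I. ennreal ((1 / real (card E)) ^ card (J i)))"
    by (intro infsum_cong_neutral) auto
  finally show ?thesis .
qed

section \<open>Constant factors in the scale\<close>

lemma scale_factor_ln:
  assumes "0 < c" "1 < \<kappa>"
  shows "\<forall>\<^sub>F \<epsilon>::real in at_right 0. 0 < \<epsilon> \<and> 0 < \<bar>ln \<epsilon>\<bar> \<and> \<bar>ln \<epsilon>\<bar> \<le> \<kappa> * \<bar>ln (c * \<epsilon>)\<bar>"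
proof -
  have "filterlim (\<lambda>\<epsilon>::real. ln \<epsilon>) at_bot (at_right 0)" by (rule ln_at_0)
  \<comment> \<open>The first two bounds make \<open>ln \<epsilon>\<close> and
    \<open>ln (c * \<epsilon>)\<close> negative; the third is
    \<open>- ln \<epsilon> \<le> - \<kappa> * (ln c + ln \<epsilon>)\<close> solved for
    \<open>ln \<epsilon>\<close>.\<close>
  then have "\<forall>\<^sub>F \<epsilon>::real in at_right 0. ln \<epsilon> \<le> min (-1) (min (- ln c - 1) (- \<kappa> * ln c / (\<kappa> - 1)))"
    unfolding filterlim_at_bot by blast
  moreover have "\<forall>\<^sub>F \<epsilon>::real in at_right 0. 0 < \<epsilon>" by (simp add: eventually_at_right_less)
  ultimately show ?thesis
  proof eventually_elim
    case (elim \<epsilon>)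
    have "ln \<epsilon> \<le> - \<kappa> * ln c / (\<kappa> - 1)" using elim by simp
    then have "(\<kappa> - 1) * ln \<epsilon> \<le> - \<kappa> * ln c" using \<open>1 < \<kappa>\<close> by (simp add: field_simps)
    moreover have "ln (c * \<epsilon>) = ln c + ln \<epsilon>" using elim assms by (simp add: ln_mult)
    moreover have "ln \<epsilon> \<le> - 1" "ln \<epsilon> \<le> - ln c - 1" using elim by simp_all
    moreover from this have "\<bar>ln \<epsilon>\<bar> = - ln \<epsilon>" "\<bar>ln c + ln \<epsilon>\<bar> = - (ln c + ln \<epsilon>)" by simp_all
    ultimately have "0 < \<bar>ln \<epsilon>\<bar>" "\<bar>ln \<epsilon>\<bar> \<le> \<kappa> * \<bar>ln (c * \<epsilon>)\<bar>" by (simp_all add: algebra_simps)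
    with elim show ?case by blast
  qed
qed

text \<open>Substituting \<open>c * \<epsilon>\<close> for \<open>\<epsilon>\<close> does not change
  the limits at 0 from the right, and it changes the denominator by a factor tending to 1. So the
  inequality holds up to any factor \<open>\<kappa> > 1\<close>; then \<open>\<kappa>\<close> tends
  to 1.\<close>

lemma
  fixes G H :: "real \<Rightarrow> ereal"
  assumes "0 < c" and le: "\<And>\<epsilon>. 0 < \<epsilon> \<Longrightarrow> G (c * \<epsilon>) \<le> H \<epsilon>" and nonneg: "\<And>\<epsilon>. 0 < \<epsilon> \<Longrightarrow> 0 \<le> H \<epsilon>"
  shows Limsup_ln_rescale_le: "Limsup (at_right 0) (\<lambda>\<epsilon>. G \<epsilon> / ereal \<bar>ln \<epsilon>\<bar>) \<le> Limsup (at_right 0) (\<lambda>\<epsilon>. H \<epsilon> / ereal \<bar>ln \<epsilon>\<bar>)"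
    and Liminf_ln_rescale_le: "Liminf (at_right 0) (\<lambda>\<epsilon>. G \<epsilon> / ereal \<bar>ln \<epsilon>\<bar>) \<le> Liminf (at_right 0) (\<lambda>\<epsilon>. H \<epsilon> / ereal \<bar>ln \<epsilon>\<bar>)"
proof -
  let ?G = "\<lambda>\<epsilon>. G \<epsilon> / ereal \<bar>ln \<epsilon>\<bar>" and ?H = "\<lambda>\<epsilon>. H \<epsilon> / ereal \<bar>ln \<epsilon>\<bar>"
  have filt: "filtermap (times c) (at_right 0) = at_right 0"
    using filtermap_times_pos_at_right[OF \<open>0 < c\<close>, of 0] by simp
  have inj: "inj (times c)" using \<open>0 < c\<close> by (simp add: inj_on_def)
  have sup: "Limsup (at_right 0) ?G = Limsup (at_right 0) (\<lambda>\<epsilon>. ?G (c * \<epsilon>))"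
    using Limsup_filtermap_eq[OF inj, of "at_right 0" ?G] filt by simp
  have inf: "Liminf (at_right 0) ?G = Liminf (at_right 0) (\<lambda>\<epsilon>. ?G (c * \<epsilon>))"
    using Liminf_filtermap_eq[OF inj, of "at_right 0" ?G] filt by simp
  have ev: "\<forall>\<^sub>F \<epsilon> in at_right 0. ?G (c * \<epsilon>) \<le> ereal \<kappa> * ?H \<epsilon>" if "1 < \<kappa>" for \<kappa>
    using scale_factor_ln[OF \<open>0 < c\<close> that]
  proof eventually_elim
    case (elim \<epsilon>)
    have "?G (c * \<epsilon>) \<le> H \<epsilon> / ereal \<bar>ln (c * \<epsilon>)\<bar>"
      using elim le[of \<epsilon>] that by (intro ereal_divide_right_mono) (auto simp: zero_less_mult_iff)
    also have "\<dots> \<le> ereal \<kappa> * ?H \<epsilon>"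
    proof -
      have pos: "0 < \<bar>ln (c * \<epsilon>)\<bar>" using elim that by (metis abs_ge_zero mult_zero_right not_le order_le_less)
      then have "1 / \<bar>ln (c * \<epsilon>)\<bar> \<le> \<kappa> / \<bar>ln \<epsilon>\<bar>" using elim by (simp add: field_simps)
      then show ?thesis
        using nonneg[of \<epsilon>] elim pos that
        by (cases "H \<epsilon>") (auto simp: divide_simps mult_ac intro: mult_left_mono)
    qed
    finally show ?case .
  qed
  have nn: "0 \<le> Limsup (at_right 0) ?H" "0 \<le> Liminf (at_right 0) ?H"
  proof -
    have "\<forall>\<^sub>F \<epsilon> in at_right 0. 0 \<le> ?H \<epsilon>"
      using scale_factor_ln[OF \<open>0 < c\<close>, of 2, simplified]
      by (rule eventually_mono) (use nonneg in auto)
    then show "0 \<le> Liminf (at_right 0) ?H" by (rule Liminf_bounded)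
    also have "\<dots> \<le> Limsup (at_right 0) ?H" by (rule Liminf_le_Limsup) simp
    finally show "0 \<le> Limsup (at_right 0) ?H" .
  qed
  \<comment> \<open>Letting \<open>\<kappa>\<close> tend to 1 also has to cover infinite values; the
    criterion used asks for \<open>z * x \<le> y\<close> for all \<open>z\<close> in
    \<open>(0, 1)\<close>, and \<open>z = 1 / \<kappa>\<close>.\<close>
  have le_if: "x \<le> y" if "\<And>\<kappa>. 1 < \<kappa> \<Longrightarrow> x \<le> ereal \<kappa> * y" "0 \<le> y" for x y :: ereal
  proof (rule ereal_le_mult_one_interval)
    fix z :: ereal assume "0 < z" "z < 1"
    then obtain r where r: "z = ereal r" "0 < r" "r < 1" by (cases z) auto
    then have "ereal r * x \<le> ereal r * (ereal (1 / r) * y)"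
      by (intro ereal_mult_left_mono that) auto
    then show "z * x \<le> y" using r by (simp add: mult.assoc[symmetric] flip: one_ereal_def)
  qed (use that in auto)
  show "Limsup (at_right 0) ?G \<le> Limsup (at_right 0) ?H"
  proof (rule le_if[OF _ nn(1)])
    fix \<kappa> :: real assume "1 < \<kappa>"
    then show "Limsup (at_right 0) ?G \<le> ereal \<kappa> * Limsup (at_right 0) ?H"
      unfolding sup using Limsup_mono[OF ev[OF \<open>1 < \<kappa>\<close>]] by (simp add: Limsup_ereal_mult_left)
  qed
  show "Liminf (at_right 0) ?G \<le> Liminf (at_right 0) ?H"
  proof (rule le_if[OF _ nn(2)])
    fix \<kappa> :: real assume "1 < \<kappa>"
    then show "Liminf (at_right 0) ?G \<le> ereal \<kappa> * Liminf (at_right 0) ?H"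
      unfolding inf using Liminf_mono[OF ev[OF \<open>1 < \<kappa>\<close>]] by (simp add: Liminf_ereal_mult_left)
  qed
qed

subsection \<open>Bowen metrics and the upper bound\<close>

lemma bowen_dist_less_iff:
  "1 \<le> n \<Longrightarrow> bowen_dist f n x y < e \<longleftrightarrow> (\<forall>i<n. dist ((f ^^ i) x) ((f ^^ i) y) < e)"
  unfolding bowen_dist_def by (subst Max_less_iff) auto

lemma less_bowen_dist_iff:
  "1 \<le> n \<Longrightarrow> e < bowen_dist f n x y \<longleftrightarrow> (\<exists>i<n. e < dist ((f ^^ i) x) ((f ^^ i) y))"
  unfolding bowen_dist_def by (subst Max_gr_iff) auto

lemma bowen_dist_commute: "bowen_dist f n x y = bowen_dist f n y x"
  by (simp add: bowen_dist_def dist_commute)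

lemma continuous_on_funpow:
  fixes f :: "'a::topological_space \<Rightarrow> 'a"
  assumes "continuous_on UNIV f"
  shows "continuous_on UNIV (f ^^ n)"
proof (induction n)
  case (Suc n)
  then show ?case
    using continuous_on_compose[OF Suc continuous_on_subset[OF assms]] by simp
qed (simp add: id_def)

context
  fixes f :: "'a::metric_space \<Rightarrow> 'a"
  assumes compact: "compact (UNIV :: 'a set)" and cont: "continuous_on UNIV f"
begin

lemma open_bowen_ball:
  assumes "1 \<le> n"
  shows "open (bowen_ball f n x e)"
proof -
  have "bowen_ball f n x e = (\<Inter>i\<in>{..<n}. {y. dist ((f ^^ i) x) ((f ^^ i) y) < e})"
    using assms by (auto simp: bowen_ball_def bowen_dist_less_iff)
  moreover have "open {y. dist ((f ^^ i) x) ((f ^^ i) y) < e}" for i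
    by (intro open_Collect_less continuous_intros continuous_on_funpow cont)
  ultimately show ?thesis by auto
qed

text \<open>By compactness finitely many Bowen balls of radius \<open>e / 2\<close> cover the space,
  and each contains at most one point of a separated set. This makes the \<open>Max\<close> in
  \<open>max_separated_card\<close> a true maximum.\<close>

lemma bounded_card_separated:
  assumes "1 \<le> n" "0 < e"
  obtains k where "\<And>E. finite E \<Longrightarrow> bowen_separated f n e E \<Longrightarrow> card E \<le> k"
proof -
  have "x \<in> bowen_ball f n x (e / 2)" for x
    unfolding bowen_ball_def mem_Collect_eq bowen_dist_less_iff[OF assms(1)] using assms(2) by simp
  then have cover: "UNIV \<subseteq> (\<Union>x. bowen_ball f n x (e / 2))" by blast
  obtain C where C: "finite C" "UNIV \<subseteq> (\<Union>x\<in>C. bowen_ball f n x (e / 2))"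
    using cover by (rule compactE_image[OF compact open_bowen_ball[OF assms(1)]])
  have "card E \<le> card C" if E: "finite E" "bowen_separated f n e E" for E
  proof -
    have "\<forall>x. \<exists>c. c \<in> C \<and> x \<in> bowen_ball f n c (e / 2)" using C(2) by blast
    then obtain h where h: "\<And>x. h x \<in> C" "\<And>x. x \<in> bowen_ball f n (h x) (e / 2)" by metis
    have "inj_on h E"
    proof (rule inj_onI, rule ccontr)
      fix x y assume xy: "x \<in> E" "y \<in> E" "h x = h y" "x \<noteq> y"
      then obtain i where i: "i < n" "e < dist ((f ^^ i) x) ((f ^^ i) y)"
        using E(2) less_bowen_dist_iff[OF assms(1)] unfolding bowen_separated_def by metis
      have near: "dist ((f ^^ i) (h z)) ((f ^^ i) z) < e / 2" for z
        using h(2)[of z, unfolded bowen_ball_def mem_Collect_eq bowen_dist_less_iff[OF assms(1)]] i(1) by blast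
      from near[of x] near[of y] xy(3)
      have "dist ((f ^^ i) (h x)) ((f ^^ i) x) < e / 2" "dist ((f ^^ i) (h x)) ((f ^^ i) y) < e / 2"
        by simp_all
      then show False
        using i(2) dist_triangle_half_r by fastforce
    qed
    then show ?thesis using h(1) C(1) by (intro card_inj_on_le[of h]) auto
  qed
  then show ?thesis by (rule that)
qed

context
  fixes n :: nat and e :: real
  assumes n: "1 \<le> n" and e: "0 < e"
begin

lemma finite_card_separated: "finite {card E | E. E \<subseteq> UNIV \<and> finite E \<and> bowen_separated f n e E}"
proof -
  obtain k where "\<And>E. finite E \<Longrightarrow> bowen_separated f n e E \<Longrightarrow> card E \<le> k"
    using bounded_card_separated[OF n e] by blast
  then show ?thesis by (intro finite_subset[OF _ finite_atMost[of k]]) auto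
qed

lemma card_le_max_separated_card:
  assumes "finite E" "bowen_separated f n e E"
  shows "card E \<le> max_separated_card f UNIV n e"
  unfolding max_separated_card_def using assms by (intro Max_ge finite_card_separated) auto

lemma max_separated_card_attained:
  obtains E where "finite E" "bowen_separated f n e E" "card E = max_separated_card f UNIV n e"
proof -
  have "bowen_separated f n e {}" by (simp add: bowen_separated_def)
  then have "{card E | E. E \<subseteq> UNIV \<and> finite E \<and> bowen_separated f n e E} \<noteq> {}" by blast
  from Max_in[OF finite_card_separated this]
  have "\<exists>E. max_separated_card f UNIV n e = card E \<and> E \<subseteq> UNIV \<and> finite E \<and> bowen_separated f n e E"
    unfolding max_separated_card_def by (simp only: mem_Collect_eq)
  then show ?thesis using that by metis
qed

lemma max_separated_card_ge_1: "1 \<le> max_separated_card f UNIV n e"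
  using card_le_max_separated_card[of "{undefined}"] by (simp add: bowen_separated_def)

text \<open>A point farther than \<open>e\<close> from every point of a largest separated set could
  be added to it.\<close>

lemma maximal_separated_spanning:
  obtains E where "finite E" "card E = max_separated_card f UNIV n e"
    "\<And>x. \<exists>c\<in>E. bowen_dist f n c x \<le> e"
proof -
  obtain E where E: "finite E" "bowen_separated f n e E" "card E = max_separated_card f UNIV n e"
    by (rule max_separated_card_attained)
  have "\<exists>c\<in>E. bowen_dist f n c x \<le> e" for x
  proof (rule ccontr)
    assume far: "\<not> ?thesis"
    have "bowen_dist f n x x < e" using n e by (simp add: bowen_dist_less_iff)
    then have "x \<notin> E" using far by fastforce
    moreover have "bowen_separated f n e (insert x E)"
      using E(2) far by (auto simp: bowen_separated_def bowen_dist_commute not_le)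
    ultimately show False
      using card_le_max_separated_card[of "insert x E"] E by simp
  qed
  with E that show ?thesis by blast
qed

end

lemma scale_entropy_nonneg: "0 < e \<Longrightarrow> 0 \<le> scale_entropy f UNIV e"
  unfolding scale_entropy_def
proof (intro le_Limsup always_eventually allI)
  fix n assume "0 < e"
  show "0 \<le> ereal (1 / real n * ln (real (max_separated_card f UNIV n e)))"
  \<comment> \<open>At \<open>n = 0\<close> the factor \<open>1 / real n\<close> is 0, so the
    unspecified value of the Bowen distance does no harm.\<close>
  proof (cases "n = 0")
    case False
    then have "1 \<le> max_separated_card f UNIV n e"
      using \<open>0 < e\<close> by (intro max_separated_card_ge_1) auto
    then show ?thesis by simp
  qed simp
qed simp

end

section \<open>Bounds for the critical value\<close>

lemma critical_bowen_entropy: "is_critical_value (\<lambda>s. bowen_measure f Z s \<epsilon>) (bowen_entropy f Z \<epsilon>)"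
  unfolding bowen_entropy_def by (rule theI'[OF ex1_critical_value_bowen_measure])

lemma bowen_entropy_leI: "bowen_measure f Z s \<epsilon> = 0 \<Longrightarrow> bowen_entropy f Z \<epsilon> \<le> ereal s"
  using critical_bowen_entropy[of f Z \<epsilon>] unfolding is_critical_value_def
  by (intro leI notI) simp

text \<open>One \<open>N\<close> suffices because the measure is the supremum of the premeasures,
  and above the critical value the measure is 0.\<close>

lemma le_bowen_entropyI:
  assumes "1 \<le> bowen_premeasure f Z s N \<epsilon>"
  shows "ereal s \<le> bowen_entropy f Z \<epsilon>"
proof -
  have "1 \<le> bowen_measure f Z s \<epsilon>"
    unfolding bowen_measure_eq_SUP using assms by (rule SUP_upper2[rotated]) simp
  then show ?thesis
    using critical_bowen_entropy[of f Z \<epsilon>] unfolding is_critical_value_def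
    by (intro leI notI) simp
qed

text \<open>At \<open>s = 0\<close> every ball costs 1, and a cover of a nonempty set uses at least
  one ball.\<close>

lemma bowen_entropy_nonneg:
  assumes "Z \<noteq> {}"
  shows "0 \<le> bowen_entropy f Z \<epsilon>"
proof -
  have "1 \<le> bowen_premeasure f Z 0 0 \<epsilon>"
    unfolding bowen_premeasure_def
  proof (rule Inf_greatest)
    fix v assume "v \<in> {\<Sum>\<^sub>\<infinity>i\<in>I. ennreal (exp (- 0 * real (n i))) |I n x. bowen_cover f Z 0 \<epsilon> I n x}"
    then obtain I n x where v: "v = (\<Sum>\<^sub>\<infinity>i\<in>I. ennreal (exp (- 0 * real (n i))))" and "bowen_cover f Z 0 \<epsilon> I n x"
      by blast
    then obtain i where "i \<in> I" using assms by (auto simp: bowen_cover_def)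
    then have "(\<Sum>\<^sub>\<infinity>j\<in>{i}. ennreal (exp (- 0 * real (n j)))) \<le> v"
      unfolding v by (intro infsum_mono_neutral nonneg_summable_on_complete) auto
    then show "1 \<le> v" by simp
  qed
  from le_bowen_entropyI[OF this] show ?thesis by (simp add: zero_ereal_def)
qed

text \<open>Cover by balls of length \<open>n\<close> around a maximal separated set. Spanning gives
  only distance at most \<open>\<epsilon>\<close>, while balls are open; the radius
  \<open>2 * \<epsilon>\<close> restores strictness.\<close>

lemma bowen_entropy_le_scale_entropy:
  fixes f :: "'a::metric_space \<Rightarrow> 'a"
  assumes "compact (UNIV :: 'a set)" "continuous_on UNIV f" "0 < \<epsilon>"
  shows "bowen_entropy f Z (2 * \<epsilon>) \<le> scale_entropy f UNIV \<epsilon>"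
proof (rule ereal_le_real)
  fix s assume "scale_entropy f UNIV \<epsilon> \<le> ereal s"
  \<comment> \<open>The exponent \<open>s'\<close> bounds the number of balls by
    \<open>exp (s' * n)\<close>, and the margin \<open>s - s'\<close> makes the total cost tend to
    0.\<close>
  have "bowen_entropy f Z (2 * \<epsilon>) \<le> ereal s" if "s' < s" "scale_entropy f UNIV \<epsilon> < ereal s'" for s s'
  proof (rule bowen_entropy_leI)
    have "\<forall>\<^sub>F n in sequentially. ereal (1 / real n * ln (real (max_separated_card f UNIV n \<epsilon>))) < ereal s'"
      using that(2) unfolding scale_entropy_def by (rule Limsup_lessD)
    then have ev: "\<forall>\<^sub>F n in sequentially. bowen_premeasure f Z s N (2 * \<epsilon>) \<le> ennreal (exp ((s' - s) * real n))" for N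
      using eventually_ge_at_top[of N] eventually_ge_at_top[of 1]
    proof eventually_elim
      case (elim n)
      let ?m = "max_separated_card f UNIV n \<epsilon>"
      have "1 \<le> ?m" using max_separated_card_ge_1[OF assms(1,2) elim(3) assms(3)] .
      moreover have "ln (real ?m) \<le> s' * real n"
        using elim by (simp add: field_simps)
      ultimately have m: "real ?m \<le> exp (s' * real n)"
        using exp_le_cancel_iff[of "ln (real ?m)" "s' * real n"] by simp
      obtain E where E: "finite E" "card E = ?m" "\<And>x. \<exists>c\<in>E. bowen_dist f n c x \<le> \<epsilon>"
        using maximal_separated_spanning[OF assms(1,2) elim(3) assms(3)] by blast
      obtain h where h: "bij_betw h {0..<?m} E" using ex_bij_betw_nat_finite[OF E(1)] unfolding E(2) by blast
      have "bowen_cover f Z N (2 * \<epsilon>) {0..<?m} (\<lambda>_. n) h"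
        unfolding bowen_cover_def
      proof (intro conjI subsetI)
        fix x
        obtain c where c: "c \<in> E" "bowen_dist f n c x \<le> \<epsilon>" using E(3) by blast
        then obtain i where "i \<in> {0..<?m}" "c = h i" using h by (auto simp: bij_betw_def)
        then show "x \<in> (\<Union>i\<in>{0..<?m}. bowen_ball f n (h i) (2 * \<epsilon>))"
          using c assms(3) unfolding bowen_ball_def by fastforce
      qed (use elim in auto)
      then have "bowen_premeasure f Z s N (2 * \<epsilon>) \<le> (\<Sum>\<^sub>\<infinity>i\<in>{0..<?m}. ennreal (exp (- s * real n)))"
        unfolding bowen_premeasure_def
        by (intro Inf_lower CollectI exI[of _ "{0..<?m}"] exI[of _ "\<lambda>_. n"] exI[of _ h] conjI) simp_all
      also have "\<dots> = ennreal (real ?m * exp (- s * real n))"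
        by (simp add: ennreal_mult ennreal_of_nat_eq_real_of_nat)
      also have "\<dots> \<le> ennreal (exp (s' * real n) * exp (- s * real n))"
        using m by (intro ennreal_leI mult_right_mono) auto
      also have "\<dots> = ennreal (exp ((s' - s) * real n))"
        by (simp add: algebra_simps flip: exp_add)
      finally show ?case .
    qed
    have "(\<lambda>n. exp (s' - s) ^ n) \<longlonglongrightarrow> 0"
      using that by (intro LIMSEQ_realpow_zero) auto
    then have "(\<lambda>n. ennreal (exp ((s' - s) * real n))) \<longlonglongrightarrow> 0"
      using tendsto_ennrealI by (fastforce simp: exp_of_nat2_mult)
    from tendsto_lowerbound[OF this ev] have "bowen_premeasure f Z s N (2 * \<epsilon>) = 0" for N
      by simp
    then show "bowen_measure f Z s (2 * \<epsilon>) = 0" by (simp add: bowen_measure_eq_SUP)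
  qed
  note bound = this
  show "bowen_entropy f Z (2 * \<epsilon>) \<le> ereal s"
  proof (rule ereal_le_epsilon2)
    fix d :: real assume "0 < d"
    then have "scale_entropy f UNIV \<epsilon> < ereal (s + d / 2)"
      using \<open>scale_entropy f UNIV \<epsilon> \<le> ereal s\<close> by (rule_tac le_less_trans) auto
    then show "bowen_entropy f Z (2 * \<epsilon>) \<le> ereal s + ereal d"
      using bound[of "s + d / 2" "s + d"] \<open>0 < d\<close> by simp
  qed
qed

subsection \<open>Shadowing and Birkhoff sums\<close>

text \<open>For segments of one common length the gaps can be chosen equal, so that the starting
  times are multiples of \<open>n + L n\<close>. Specification shadows finitely many segments; a
  limit point of these shadowing points serves all of them, at the price of a non-strict
  inequality.\<close>

lemma specification_periodic_shadowing:
  fixes f :: "'a::metric_space \<Rightarrow> 'a"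
  assumes compact: "compact (UNIV :: 'a set)" and cont: "continuous_on UNIV f"
    and "almost_weak_specification f" "0 < \<epsilon>"
  obtains L where "tempered L"
    "\<And>n x. 1 \<le> n \<Longrightarrow> \<exists>y. \<forall>j. \<forall>i<n. dist ((f ^^ (j * (n + L n) + i)) y) ((f ^^ i) (x j)) \<le> \<epsilon>"
proof -
  from assms(3)[unfolded almost_weak_specification_def, rule_format, OF assms(4)]
  obtain L where L: "tempered L" and spec_all: "\<forall>k\<ge>1. \<forall>(x :: nat \<Rightarrow> 'a) (a :: nat \<Rightarrow> nat) (b :: nat \<Rightarrow> nat).
        (\<forall>j\<in>{1..k}. 0 < a j \<and> a j \<le> b j) \<and>
        (\<forall>j\<in>{1..<k}. b j < a (j + 1) \<and> L (b (j + 1) - a (j + 1)) \<le> a (j + 1) - b j) \<longrightarrow>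
        (\<exists>y. \<forall>j\<in>{1..k}. \<forall>i\<in>{a j..b j}. dist ((f ^^ i) y) ((f ^^ (i - a j)) (x j)) < \<epsilon>)"
    by (elim exE conjE)
  note shadow = spec_all[THEN spec, THEN mp, THEN spec, THEN spec, THEN spec, THEN mp, OF _ conjI]
  have "\<exists>y. \<forall>j. \<forall>i<n. dist ((f ^^ (j * (n + L n) + i)) y) ((f ^^ i) (x j)) \<le> \<epsilon>" if n: "1 \<le> n" for n and x :: "nat \<Rightarrow> 'a"
  proof -
    define P where "P = n + L n"
    \<comment> \<open>A segment of \<open>n\<close> points has \<open>b j - a j = n - 1\<close>, so
      specification asks for a gap of \<open>L (n - 1)\<close>.\<close>
    have Ln: "L (n - 1) \<le> L n" using L by (auto simp: tempered_def intro: monoD)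
    have "\<exists>y. \<forall>j<k. \<forall>i<n. dist ((f ^^ (j * P + i)) y) ((f ^^ i) (x j)) < \<epsilon>" for k
    proof -
      \<comment> \<open>Specification numbers segments from 1 and wants positive times, so
        everything is shifted by one; below, passing from \<open>y\<close> to \<open>f y\<close>
        undoes the shift in time.\<close>
      define a where "a j = Suc ((j - 1) * P)" for j
      define b where "b j = a j + (n - 1)" for j
      have step: "b j < a (j + 1) \<and> L (b (j + 1) - a (j + 1)) \<le> a (j + 1) - b j" if "1 \<le> j" for j
      proof -
        have "a (j + 1) = a j + P" using that by (cases j) (auto simp: a_def)
        then show ?thesis using n Ln by (auto simp: b_def P_def)
      qed
      obtain y where y: "\<forall>j\<in>{1..Suc k}. \<forall>i\<in>{a j..b j}. dist ((f ^^ i) y) ((f ^^ (i - a j)) (x (j - 1))) < \<epsilon>"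
        using shadow[of "Suc k" a b "\<lambda>j. x (j - 1)"] step by (auto simp: a_def b_def)
      have "dist ((f ^^ (j * P + i)) (f y)) ((f ^^ i) (x j)) < \<epsilon>" if "j < k" "i < n" for i j
      proof -
        have "dist ((f ^^ (a (Suc j) + i)) y) ((f ^^ (a (Suc j) + i - a (Suc j))) (x (Suc j - 1))) < \<epsilon>"
          using that by (intro y[rule_format]) (auto simp: b_def)
        then show ?thesis by (simp add: a_def funpow_swap1)
      qed
      then show ?thesis by blast
    qed
    then obtain u where u: "\<And>k j i. j < k \<Longrightarrow> i < n \<Longrightarrow> dist ((f ^^ (j * P + i)) (u k)) ((f ^^ i) (x j)) < \<epsilon>"
      by metis
    obtain y r where r: "strict_mono (r :: nat \<Rightarrow> nat)" "(u \<circ> r) \<longlonglongrightarrow> y"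
      using compact[unfolded compact_def] by (metis UNIV_I)
    have "dist ((f ^^ (j * P + i)) y) ((f ^^ i) (x j)) \<le> \<epsilon>" if "i < n" for i j
    proof (rule tendsto_upperbound)
      have "isCont (f ^^ (j * P + i)) y"
        using continuous_on_funpow[OF cont] by (simp add: continuous_on_eq_continuous_at)
      from isCont_tendsto_compose[OF this r(2)]
      show "(\<lambda>k. dist ((f ^^ (j * P + i)) (u (r k))) ((f ^^ i) (x j))) \<longlonglongrightarrow> dist ((f ^^ (j * P + i)) y) ((f ^^ i) (x j))"
        by (auto intro: tendsto_intros simp: o_def)
      show "\<forall>\<^sub>F k in sequentially. dist ((f ^^ (j * P + i)) (u (r k))) ((f ^^ i) (x j)) \<le> \<epsilon>"
        using eventually_gt_at_top[of j]
      proof eventually_elim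
        case (elim k)
        \<comment> \<open>For fixed \<open>j\<close>, all later points \<open>u (r k)\<close> shadow
          the segment \<open>j\<close>, as \<open>r k\<close> is at least \<open>k\<close>.\<close>
        then have "j < r k" using seq_suble[OF r(1), of k] by simp
        then show ?case using u that less_imp_le by blast
      qed
    qed simp
    then show ?thesis unfolding P_def by blast
  qed
  with L that show ?thesis by blast
qed

section \<open>Birkhoff sums and oscillation\<close>

definition birkhoff_sum :: "('a \<Rightarrow> 'a) \<Rightarrow> ('a \<Rightarrow> real) \<Rightarrow> nat \<Rightarrow> 'a \<Rightarrow> real" where
  "birkhoff_sum f \<phi> n x = (\<Sum>i<n. \<phi> ((f ^^ i) x))"

lemma irregular_set_birkhoff_sum:
  "irregular_set f \<phi> = {x. \<not> convergent (\<lambda>n. 1 / real n * birkhoff_sum f \<phi> n x)}"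
  by (simp add: irregular_set_def birkhoff_sum_def atLeast0LessThan)

lemma birkhoff_sum_add:
  "birkhoff_sum f \<phi> (m + n) x = birkhoff_sum f \<phi> m x + birkhoff_sum f \<phi> n ((f ^^ m) x)"
proof (induction n)
  case (Suc n)
  have "(f ^^ (m + n)) x = (f ^^ n) ((f ^^ m) x)"
    by (metis add.commute comp_apply funpow_add)
  with Suc show ?case by (simp add: birkhoff_sum_def)
qed (simp add: birkhoff_sum_def)

lemma birkhoff_sum_uminus: "birkhoff_sum f (\<lambda>x. - \<phi> x) n x = - birkhoff_sum f \<phi> n x"
  by (simp add: birkhoff_sum_def sum_negf)

lemma abs_birkhoff_sum_le:
  assumes "\<And>x. \<bar>\<phi> x\<bar> \<le> B"
  shows "\<bar>birkhoff_sum f \<phi> n x\<bar> \<le> real n * B"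
proof -
  have "\<bar>birkhoff_sum f \<phi> n x\<bar> \<le> (\<Sum>i<n. \<bar>\<phi> ((f ^^ i) x)\<bar>)"
    unfolding birkhoff_sum_def by (rule sum_abs)
  also have "\<dots> \<le> real (card {..<n}) * B"
    by (intro sum_bounded_above assms)
  finally show ?thesis by simp
qed

text \<open>Split \<open>n\<close> into blocks of length \<open>M\<close> and a remainder of length
  at most \<open>M\<close>; the remainder causes the only error, which is bounded independently of
  \<open>n\<close>.\<close>

lemma birkhoff_sum_lower_bound_all_times:
  assumes B: "\<And>x. \<bar>\<phi> x\<bar> \<le> B" and M: "1 \<le> M"
    and low: "\<And>x. real M * \<alpha> \<le> birkhoff_sum f \<phi> M x"
  shows "real n * \<alpha> - real M * (B + \<bar>\<alpha>\<bar>) \<le> birkhoff_sum f \<phi> n x"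
proof -
  have "0 \<le> B" using B[of undefined] by simp
  have blocks: "real (k * M) * \<alpha> - real r * B \<le> birkhoff_sum f \<phi> (k * M + r) x" for k r x
  proof (induction k arbitrary: x)
    case 0
    then show ?case using abs_birkhoff_sum_le[of \<phi> B f r x] B by simp
  next
    case (Suc k)
    have "birkhoff_sum f \<phi> (Suc k * M + r) x = birkhoff_sum f \<phi> M x + birkhoff_sum f \<phi> (k * M + r) ((f ^^ M) x)"
      using birkhoff_sum_add[of f \<phi> M "k * M + r" x] by (simp add: add.assoc)
    then show ?case
      using low[of x] Suc[of "(f ^^ M) x"] by (simp add: algebra_simps)
  qed
  define k r where "k = n div M" and "r = n mod M"
  have n: "n = k * M + r" and r: "r \<le> M" using M by (auto simp: k_def r_def less_imp_le)
  have "real r * \<alpha> \<le> real M * \<bar>\<alpha>\<bar>"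
    using r by (intro order_trans[OF mult_left_mono mult_right_mono]) auto
  moreover have "real r * B \<le> real M * B"
    using r \<open>0 \<le> B\<close> by (intro mult_right_mono) auto
  ultimately show ?thesis
    using blocks[of k r x] unfolding n by (simp add: algebra_simps)
qed

lemma birkhoff_average_liminf_ge:
  assumes B: "\<And>x. \<bar>\<phi> x\<bar> \<le> B" and M: "1 \<le> M"
    and low: "\<And>x. real M * \<alpha> \<le> birkhoff_sum f \<phi> M x"
    and "l < \<alpha>"
  shows "\<forall>\<^sub>F n in sequentially. l \<le> 1 / real n * birkhoff_sum f \<phi> n x"
proof -
  define C where "C = real M * (B + \<bar>\<alpha>\<bar>)"
  have "(\<lambda>n. \<alpha> - C / real n) \<longlonglongrightarrow> \<alpha> - 0"
    by (intro tendsto_intros lim_const_over_n)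
  then have "\<forall>\<^sub>F n in sequentially. l < \<alpha> - C / real n"
    using \<open>l < \<alpha>\<close> by (intro order_tendstoD(1)) auto
  with eventually_gt_at_top[of 0] show ?thesis
  proof eventually_elim
    case (elim n)
    have "real n * \<alpha> - C \<le> birkhoff_sum f \<phi> n x"
      unfolding C_def by (rule birkhoff_sum_lower_bound_all_times[OF B M low])
    then have "(real n * \<alpha> - C) / real n \<le> birkhoff_sum f \<phi> n x / real n"
      by (rule divide_right_mono) simp
    then have "\<alpha> - C / real n \<le> 1 / real n * birkhoff_sum f \<phi> n x"
      using elim by (simp add: diff_divide_distrib)
    with elim show ?case by simp
  qed
qed

text \<open>
  A one-sided bound on the averages over all orbit segments of a single length would persist in
  the limit and contradict the oscillation at an irregular point.
\<close>

lemma irregular_set_oscillation: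
  assumes B: "\<And>x. \<bar>\<phi> x\<bar> \<le> B" and "irregular_set f \<phi> \<noteq> {}"
  obtains \<alpha> \<beta> where "\<alpha> < \<beta>"
    "\<And>n. 1 \<le> n \<Longrightarrow> \<exists>z. birkhoff_sum f \<phi> n z \<le> real n * \<alpha>"
    "\<And>n. 1 \<le> n \<Longrightarrow> \<exists>z. real n * \<beta> \<le> birkhoff_sum f \<phi> n z"
proof -
  obtain z where z: "\<not> convergent (\<lambda>n. 1 / real n * birkhoff_sum f \<phi> n z)"
    using assms(2) by (auto simp: irregular_set_birkhoff_sum)
  define X where "X n = 1 / real n * birkhoff_sum f \<phi> n z" for n
  have "\<bar>X n\<bar> \<le> B" for n
  proof (cases "n = 0")
    case False
    then show ?thesis
      using abs_birkhoff_sum_le[of \<phi> B f n z] B by (simp add: X_def abs_mult field_simps)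
  qed (use B[of undefined] in \<open>simp add: X_def\<close>)
  then have X: "- B \<le> X n" "X n \<le> B" for n
    by (simp_all add: abs_le_iff minus_le_iff)
  have "liminf (\<lambda>n. ereal (X n)) \<noteq> limsup (\<lambda>n. ereal (X n))"
  proof
    assume eq: "liminf (\<lambda>n. ereal (X n)) = limsup (\<lambda>n. ereal (X n))"
    define L where "L = limsup (\<lambda>n. ereal (X n))"
    have "ereal (- B) \<le> L" unfolding L_def
      by (intro le_Limsup always_eventually allI) (use X in simp_all)
    moreover have "L \<le> ereal B" unfolding L_def
      by (intro Limsup_bounded always_eventually allI) (use X in simp_all)
    ultimately obtain r where r: "L = ereal r" by (cases L) auto
    have "(\<lambda>n. ereal (X n)) \<longlonglongrightarrow> ereal r"
      using eq r unfolding L_def by (subst tendsto_iff_Liminf_eq_Limsup) auto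
    then have "X \<longlonglongrightarrow> r" by simp
    with z show False unfolding X_def convergent_def by blast
  qed
  then have "liminf (\<lambda>n. ereal (X n)) < limsup (\<lambda>n. ereal (X n))"
    using Liminf_le_Limsup[of sequentially "\<lambda>n. ereal (X n)"] by simp
  then obtain l where l: "liminf (\<lambda>n. ereal (X n)) < ereal l" "ereal l < limsup (\<lambda>n. ereal (X n))"
    using ereal_dense2 by blast
  then obtain u where u: "ereal l < ereal u" "ereal u < limsup (\<lambda>n. ereal (X n))"
    using ereal_dense2 by blast
  \<comment> \<open>Trisecting \<open>[l, u]\<close> leaves strict room on both sides, as
    \<open>birkhoff_average_liminf_ge\<close> demands.\<close>
  define \<alpha> \<beta> where "\<alpha> = (2 * l + u) / 3" and "\<beta> = (l + 2 * u) / 3"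
  have order: "l < \<alpha>" "\<alpha> < \<beta>" "\<beta> < u" using u by (auto simp: \<alpha>_def \<beta>_def)
  have "\<exists>x. birkhoff_sum f \<phi> n x \<le> real n * \<alpha>" if "1 \<le> n" for n
  proof (rule ccontr)
    assume "\<not> ?thesis"
    then have "real n * \<alpha> \<le> birkhoff_sum f \<phi> n x" for x by (meson less_imp_le not_le)
    from birkhoff_average_liminf_ge[OF B that this order(1)]
    have "\<forall>\<^sub>F n in sequentially. ereal l \<le> ereal (X n)" by (simp add: X_def)
    then have "ereal l \<le> liminf (\<lambda>n. ereal (X n))" by (rule Liminf_bounded)
    with l show False by simp
  qed
  \<comment> \<open>The upper bound is the lower one for \<open>- \<phi>\<close>, with
    \<open>- u < - \<beta>\<close>.\<close>
  moreover have "\<exists>x. real n * \<beta> \<le> birkhoff_sum f \<phi> n x" if "1 \<le> n" for n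
  proof (rule ccontr)
    assume "\<not> ?thesis"
    then have "birkhoff_sum f \<phi> n x \<le> real n * \<beta>" for x by (meson less_imp_le not_le)
    then have "real n * (- \<beta>) \<le> birkhoff_sum f (\<lambda>x. - \<phi> x) n x" for x by (simp add: birkhoff_sum_uminus)
    from birkhoff_average_liminf_ge[OF _ that this, of B "- u"]
    have "\<forall>\<^sub>F n in sequentially. ereal (X n) \<le> ereal u"
      using B order by (simp add: X_def birkhoff_sum_uminus)
    then have "limsup (\<lambda>n. ereal (X n)) \<le> ereal u" by (rule Limsup_bounded)
    with u show False by simp
  qed
  ultimately show ?thesis using that[OF order(2)] by blast
qed

text \<open>Group the periods into cells of \<open>q\<close>. The first segment of a cell is the
  fixed low or high one, chosen by the parity of \<open>floor_log\<close>, that is by the dyadic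
  range of the cell index. The other segments contribute nearly the same to every cell, so the
  increments over cells oscillate.\<close>

lemma shadowing_point_irregular:
  assumes shadow: "\<And>j i. i < n \<Longrightarrow> dist ((f ^^ (j * (n + g) + i)) y) ((f ^^ i) (x j)) \<le> \<epsilon>"
    and modulus: "\<And>u v. dist u v \<le> \<epsilon> \<Longrightarrow> \<bar>\<phi> u - \<phi> v\<bar> \<le> \<delta>"
    and B: "\<And>x. \<bar>\<phi> x\<bar> \<le> B" and gap: "real g * B \<le> real n * \<delta>"
    and n: "1 \<le> n" and q: "1 \<le> q" and \<delta>: "0 < \<delta>" "6 * real q * \<delta> \<le> \<beta> - \<alpha>"
    and middle: "\<And>j. \<not> q dvd j \<Longrightarrow> real n * c \<le> birkhoff_sum f \<phi> n (x j) \<and> birkhoff_sum f \<phi> n (x j) \<le> real n * (c + \<delta>)"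
    and low: "\<And>k. even (floor_log k) \<Longrightarrow> birkhoff_sum f \<phi> n (x (k * q)) \<le> real n * \<alpha>"
    and high: "\<And>k. odd (floor_log k) \<Longrightarrow> real n * \<beta> \<le> birkhoff_sum f \<phi> n (x (k * q))"
  shows "y \<in> irregular_set f \<phi>"
proof -
  define P where "P = n + g"
  define S where "S m = birkhoff_sum f \<phi> m y" for m
  define D where "D j = S (Suc j * P) - S (j * P)" for j
  \<comment> \<open>One \<open>n * \<delta>\<close> comes from shadowing, the other from the
    gap.\<close>
  have D: "\<bar>D j - birkhoff_sum f \<phi> n (x j)\<bar> \<le> 2 * real n * \<delta>" for j
  proof -
    let ?y = "(f ^^ (j * P)) y"
    have "D j = birkhoff_sum f \<phi> n ?y + birkhoff_sum f \<phi> g ((f ^^ n) ?y)"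
      using birkhoff_sum_add[of f \<phi> "j * P" P y] birkhoff_sum_add[of f \<phi> n g ?y]
      unfolding D_def S_def by (simp add: P_def add.commute)
    moreover have "\<bar>birkhoff_sum f \<phi> g ((f ^^ n) ?y)\<bar> \<le> real n * \<delta>"
      using abs_birkhoff_sum_le[of \<phi> B f g] B gap order_trans by blast
    moreover have "\<bar>birkhoff_sum f \<phi> n ?y - birkhoff_sum f \<phi> n (x j)\<bar> \<le> real n * \<delta>"
    proof -
      have "\<bar>birkhoff_sum f \<phi> n ?y - birkhoff_sum f \<phi> n (x j)\<bar>
          \<le> (\<Sum>i<n. \<bar>\<phi> ((f ^^ i) ?y) - \<phi> ((f ^^ i) (x j))\<bar>)"
        unfolding birkhoff_sum_def sum_subtractf[symmetric] by (rule sum_abs)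
      also have "\<dots> \<le> real (card {..<n}) * \<delta>"
      proof (rule sum_bounded_above)
        fix i assume "i \<in> {..<n}"
        then have "dist ((f ^^ (i + j * P)) y) ((f ^^ i) (x j)) \<le> \<epsilon>"
          using shadow[of i j] by (simp add: P_def add.commute)
        then show "\<bar>\<phi> ((f ^^ i) ?y) - \<phi> ((f ^^ i) (x j))\<bar> \<le> \<delta>"
          by (intro modulus) (simp add: funpow_add)
      qed
      finally show ?thesis by simp
    qed
    ultimately show ?thesis by simp
  qed
  obtain p where p: "q = Suc p" using q by (cases q) auto
  have cell: "S (Suc k * (q * P)) - S (k * (q * P)) = D (k * q) + (\<Sum>s<p. D (k * q + Suc s))" for k
  proof -
    have "(\<Sum>s<q. D (k * q + s)) = (\<Sum>s<q. S ((k * q + Suc s) * P) - S ((k * q + s) * P))"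
      by (simp add: D_def)
    also have "\<dots> = S ((k * q + q) * P) - S ((k * q + 0) * P)"
      by (rule sum_lessThan_telescope)
    finally show ?thesis
      unfolding p sum.lessThan_Suc_shift by (simp add: algebra_simps)
  qed
  have not_dvd: "\<not> q dvd k * q + Suc s" if "s < p" for k s
  proof -
    have "\<not> q dvd Suc s" using that p by (auto dest: dvd_imp_le)
    then show ?thesis using dvd_add_right_iff[of q "k * q" "Suc s"] by (simp only: dvd_triv_right) simp
  qed
  define U where "U = real n * \<alpha> + real p * (real n * (c + \<delta>)) + 2 * real q * real n * \<delta>"
  define V where "V = real n * \<beta> + real p * (real n * c) - 2 * real q * real n * \<delta>"
  have mid: "D (k * q + Suc s) \<le> real n * (c + \<delta>) + 2 * real n * \<delta>" "real n * c - 2 * real n * \<delta> \<le> D (k * q + Suc s)" if "s < p" for k s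
    using D[of "k * q + Suc s"] middle[OF not_dvd[OF that, of k]] by (simp_all add: abs_le_iff)
  have upper: "(\<Sum>s<p. D (k * q + Suc s)) \<le> real (card {..<p}) * (real n * (c + \<delta>) + 2 * real n * \<delta>)" for k
    by (intro sum_bounded_above mid) auto
  have lower: "real (card {..<p}) * (real n * c - 2 * real n * \<delta>) \<le> (\<Sum>s<p. D (k * q + Suc s))" for k
    by (intro sum_bounded_below mid) auto
  have "\<not> convergent (\<lambda>m. 1 / real m * S m)"
  proof (rule not_convergent_averages_if_dyadic_blocks)
    show "0 < q * P" using q n by (simp add: P_def)
    \<comment> \<open>The errors of \<open>q\<close> periods enter \<open>U\<close> and
      \<open>V\<close> with \<open>2 * q * n * \<delta>\<close> each, and the spread of the middle
      segments adds \<open>(q - 1) * n * \<delta>\<close>: less than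
      \<open>5 * q * n * \<delta>\<close> in total.\<close>
    have "5 * real q * \<delta> < \<beta> - \<alpha>" using \<delta> q by (simp add: mult_less_cancel_right_pos order_less_le_trans[rotated])
    then have "real n * (5 * real q * \<delta>) < real n * (\<beta> - \<alpha>)" using n by simp
    moreover have "V - U = real n * (\<beta> - \<alpha>) - real n * (5 * real q * \<delta>) + real n * \<delta>"
      by (simp add: U_def V_def p algebra_simps)
    moreover have "0 < real n * \<delta>" using n \<delta> by simp
    ultimately show "U < V" by linarith
  next
    fix i k :: nat assume "even i" "2 ^ i \<le> k" "k < 2 ^ Suc i"
    then have "even (floor_log k)" using floor_log_eqI[of k i] by (simp add: order_less_le_trans[of 0 "2 ^ i"])
    then show "S (Suc k * (q * P)) - S (k * (q * P)) \<le> U"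
      unfolding cell using low[of k] D[of "k * q"] upper[of k]
      by (simp add: U_def p abs_le_iff algebra_simps)
  next
    fix i k :: nat assume "odd i" "2 ^ i \<le> k" "k < 2 ^ Suc i"
    then have "odd (floor_log k)" using floor_log_eqI[of k i] by (simp add: order_less_le_trans[of 0 "2 ^ i"])
    then show "V \<le> S (Suc k * (q * P)) - S (k * (q * P))"
      unfolding cell using high[of k] D[of "k * q"] lower[of k]
      by (simp add: V_def p abs_le_iff algebra_simps)
  qed
  then show ?thesis by (simp add: irregular_set_birkhoff_sum S_def)
qed

subsection \<open>The lower bound\<close>

lemma card_not_dvd_ge: "(q - 1) * k \<le> card {j. j < q * k \<and> \<not> q dvd j}"
proof -
  have "{..<q * k} \<subseteq> {j. j < q * k \<and> \<not> q dvd j} \<union> (\<lambda>i. q * i) ` {..<k}"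
    by (auto elim!: dvdE)
  then have "card {..<q * k} \<le> card ({j. j < q * k \<and> \<not> q dvd j} \<union> (\<lambda>i. q * i) ` {..<k})"
    by (intro card_mono) auto
  also have "\<dots> \<le> card {j. j < q * k \<and> \<not> q dvd j} + card ((\<lambda>i. q * i) ` {..<k})"
    by (rule card_Un_le)
  also have "card ((\<lambda>i. q * i) ` {..<k}) \<le> k"
    using card_image_le[of "{..<k}" "\<lambda>i. q * i"] by simp
  finally show ?thesis by (simp add: diff_mult_distrib)
qed

text \<open>If two coded points share a ball of length \<open>m\<close>, their codes agree at every
  free position completed before time \<open>m\<close>, since otherwise separation would be
  violated. Each ball thus picks out a cylinder, and \<open>growth\<close> bounds the mass of that
  cylinder by the cost of the ball.\<close>

lemma bowen_premeasure_ge_1_if_coded: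
  fixes f :: "'a::metric_space \<Rightarrow> 'a" and Y :: "(nat \<Rightarrow> 'a) \<Rightarrow> 'a"
  assumes E: "finite E" "E \<noteq> {}" "bowen_separated f n (3 * \<epsilon>) E"
    and n: "1 \<le> n" "n \<le> P" and "1 \<le> q"
    and Y: "\<And>\<omega>. \<omega> \<in> UNIV \<rightarrow> E \<Longrightarrow> Y \<omega> \<in> Z"
    and shadow: "\<And>\<omega> j i. \<omega> \<in> UNIV \<rightarrow> E \<Longrightarrow> \<not> q dvd j \<Longrightarrow> i < n \<Longrightarrow>
      dist ((f ^^ (j * P + i)) (Y \<omega>)) ((f ^^ i) (\<omega> j)) \<le> \<epsilon> / 2"
    and growth: "\<And>m. N \<le> m \<Longrightarrow> s * real m \<le> real ((q - 1) * (m div (q * P))) * ln (real (card E))"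
  shows "1 \<le> bowen_premeasure f Z s N \<epsilon>"
  unfolding bowen_premeasure_def
proof (rule Inf_greatest)
  fix v assume "v \<in> {\<Sum>\<^sub>\<infinity>i\<in>I. ennreal (exp (- s * real (m i))) |I m x. bowen_cover f Z N \<epsilon> I m x}"
  then obtain I m x where v: "v = (\<Sum>\<^sub>\<infinity>i\<in>I. ennreal (exp (- s * real (m i))))"
    and cover: "bowen_cover f Z N \<epsilon> I m x"
    by blast
  \<comment> \<open>Free positions in the cells of \<open>q\<close> periods that end by time
    \<open>m i\<close>.\<close>
  define J where "J i = {j. j < q * (m i div (q * P)) \<and> \<not> q dvd j}" for i
  define A where "A i = {\<omega>. Y \<omega> \<in> bowen_ball f (m i) (x i) \<epsilon>}" for i
  have "1 \<le> (\<Sum>\<^sub>\<infinity>i\<in>I. ennreal ((1 / real (card E)) ^ card (J i)))"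
  proof (rule sum_cylinder_cover_ge_1[OF E(1,2), where A = A])
    show "(UNIV \<rightarrow> E) \<subseteq> (\<Union>i\<in>I. A i)"
      using cover Y unfolding bowen_cover_def A_def by blast
  next
    fix i \<omega> \<omega>' j
    assume *: "i \<in> I" "\<omega> \<in> A i" "\<omega>' \<in> A i" "j \<in> J i" "\<omega> \<in> UNIV \<rightarrow> E" "\<omega>' \<in> UNIV \<rightarrow> E"
    have mi: "1 \<le> m i" using cover * by (auto simp: bowen_cover_def)
    show "\<omega> j = \<omega>' j"
    proof (rule ccontr)
      assume "\<omega> j \<noteq> \<omega>' j"
      moreover have "\<omega> j \<in> E" "\<omega>' j \<in> E" using * by auto
      ultimately have "3 * \<epsilon> < bowen_dist f n (\<omega> j) (\<omega>' j)"
        using E(3) by (simp add: bowen_separated_def)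
      then obtain t where t: "t < n" "3 * \<epsilon> < dist ((f ^^ t) (\<omega> j)) ((f ^^ t) (\<omega>' j))"
        using less_bowen_dist_iff[OF n(1)] by blast
      have j: "Suc j \<le> q * (m i div (q * P))" "\<not> q dvd j" using *(4) by (auto simp: J_def)
      have "j * P + t < Suc j * P" using t n by simp
      also have "\<dots> \<le> q * (m i div (q * P)) * P" using j(1) by (rule mult_le_mono1)
      also have "\<dots> = (m i div (q * P)) * (q * P)" by simp
      also have "\<dots> \<le> m i" by (rule div_times_less_eq_dividend)
      finally have "j * P + t < m i" .
      then have "dist ((f ^^ (j * P + t)) (x i)) ((f ^^ (j * P + t)) (Y \<omega>)) < \<epsilon>"
        "dist ((f ^^ (j * P + t)) (x i)) ((f ^^ (j * P + t)) (Y \<omega>')) < \<epsilon>"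
        using *(2,3) unfolding A_def bowen_ball_def mem_Collect_eq bowen_dist_less_iff[OF mi] by blast+
      moreover have "dist ((f ^^ (j * P + t)) (Y \<omega>)) ((f ^^ t) (\<omega> j)) \<le> \<epsilon> / 2"
        "dist ((f ^^ (j * P + t)) (Y \<omega>')) ((f ^^ t) (\<omega>' j)) \<le> \<epsilon> / 2"
        using shadow[OF *(5) j(2) t(1)] shadow[OF *(6) j(2) t(1)] by simp_all
      \<comment> \<open>The distances add up to less than
        \<open>\<epsilon> / 2 + \<epsilon> + \<epsilon> + \<epsilon> / 2\<close>, which explains the
        separation scale \<open>3 * \<epsilon>\<close>.\<close>
      ultimately show False
        using t(2) by metric
    qed
  qed (simp add: J_def)
  also have "\<dots> \<le> v"
    unfolding v
  proof (intro infsum_mono nonneg_summable_on_complete ennreal_leI)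
    fix i assume "i \<in> I"
    let ?e = "real (card E)"
    have e: "1 \<le> ?e" using E(1,2) by (simp add: Suc_le_eq card_gt_0_iff)
    have "N \<le> m i" using cover \<open>i \<in> I\<close> by (simp add: bowen_cover_def)
    from growth[OF this] have "exp (s * real (m i)) \<le> exp (real ((q - 1) * (m i div (q * P))) * ln ?e)"
      by simp
    also have "\<dots> = ?e ^ ((q - 1) * (m i div (q * P)))"
      using e by (simp only: exp_of_nat_mult) simp
    also have "\<dots> \<le> ?e ^ card (J i)"
      unfolding J_def using e by (intro power_increasing card_not_dvd_ge)
    finally have "1 / ?e ^ card (J i) \<le> 1 / exp (s * real (m i))"
      by (intro divide_left_mono) (use e in auto)
    then show "(1 / ?e) ^ card (J i) \<le> exp (- s * real (m i))"
      by (simp add: power_one_over exp_minus inverse_eq_divide)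
  qed auto
  finally show "1 \<le> v" .
qed

text \<open>The parameters are chosen in the order \<open>s < r\<close>, then \<open>q\<close>,
  \<open>\<delta>\<close>, \<open>e\<close>, \<open>L\<close> and \<open>K\<close>, and only then
  \<open>n\<close>, so that the gap \<open>L n\<close> and the factor \<open>K\<close> are
  negligible compared to \<open>n\<close>.\<close>

lemma scale_entropy_le_bowen_entropy_irregular_set:
  fixes f :: "'a::metric_space \<Rightarrow> 'a"
  assumes compact: "compact (UNIV :: 'a set)" and cont: "continuous_on UNIV f"
    and spec: "almost_weak_specification f" and cont_\<phi>: "continuous_on UNIV \<phi>"
    and irregular: "irregular_set f \<phi> \<noteq> {}" and "0 < \<epsilon>"
  shows "scale_entropy f UNIV (3 * \<epsilon>) \<le> bowen_entropy f (irregular_set f \<phi>) \<epsilon>"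
proof (rule dense_le)
  fix t assume t: "t < scale_entropy f UNIV (3 * \<epsilon>)"
  show "t \<le> bowen_entropy f (irregular_set f \<phi>) \<epsilon>"
  proof (cases "t < 0")
    case True
    then show ?thesis using bowen_entropy_nonneg[OF irregular, of f \<epsilon>] by (meson less_imp_le order_trans)
  next
    case False
    then obtain s where s: "t = ereal s" "0 \<le> s" using t by (cases t) auto
    obtain r where r: "ereal s < ereal r" "ereal r < scale_entropy f UNIV (3 * \<epsilon>)"
      using t s(1) ereal_dense2 by blast
    then have "s < r" "0 < r" using s by auto
    obtain B where B: "\<And>x. \<bar>\<phi> x\<bar> \<le> B"
      using compact_imp_bounded[OF compact_continuous_image[OF cont_\<phi> compact]]
      by (auto simp: bounded_iff)
    obtain \<alpha> \<beta> where \<alpha>\<beta>: "\<alpha> < \<beta>"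
      and lows: "\<And>n. 1 \<le> n \<Longrightarrow> \<exists>z. birkhoff_sum f \<phi> n z \<le> real n * \<alpha>"
      and highs: "\<And>n. 1 \<le> n \<Longrightarrow> \<exists>z. real n * \<beta> \<le> birkhoff_sum f \<phi> n z"
      using irregular_set_oscillation[OF B irregular] by blast
    \<comment> \<open>This is \<open>s < (1 - 1 / q) * r\<close>: the fixed segments may use up the
      fraction \<open>1 / q\<close>.\<close>
    obtain q :: nat where q: "r / (r - s) < real q" using reals_Archimedean2 by blast
    have "0 < r / (r - s)" using \<open>s < r\<close> \<open>0 < r\<close> by simp
    then have q1: "1 \<le> q" using q by (cases q) auto
    have qs: "s < real (q - 1) / real q * r"
    proof -
      have "r < real q * (r - s)" using q \<open>s < r\<close> by (simp add: field_simps)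
      then show ?thesis using q1 by (simp add: of_nat_diff field_simps)
    qed
    define \<delta> where "\<delta> = (\<beta> - \<alpha>) / (6 * real q)"
    have \<delta>: "0 < \<delta>" "6 * real q * \<delta> \<le> \<beta> - \<alpha>" using \<alpha>\<beta> q1 by (simp_all add: \<delta>_def)
    have "uniformly_continuous_on UNIV \<phi>" using cont_\<phi> compact by (rule compact_uniformly_continuous)
    then obtain d where d: "0 < d" "\<And>u v. dist u v < d \<Longrightarrow> dist (\<phi> u) (\<phi> v) < \<delta>"
      unfolding uniformly_continuous_on_def using \<delta>(1) by (metis UNIV_I)
    \<comment> \<open>\<open>\<epsilon> / 2\<close> serves the coding, \<open>d / 2\<close> the
      modulus of continuity of \<open>\<phi>\<close>.\<close>
    define e where "e = min (\<epsilon> / 2) (d / 2)"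
    have e: "0 < e" "e \<le> \<epsilon> / 2" "e < d" using \<open>0 < \<epsilon>\<close> d(1) by (auto simp: e_def)
    have modulus: "\<bar>\<phi> u - \<phi> v\<bar> \<le> \<delta>" if "dist u v \<le> e" for u v
      using d(2)[of u v] that e(3) by (simp add: dist_real_def)
    obtain L where L: "tempered L"
      and shadowing: "\<And>n x. 1 \<le> n \<Longrightarrow> \<exists>y. \<forall>j. \<forall>i<n. dist ((f ^^ (j * (n + L n) + i)) y) ((f ^^ i) (x j)) \<le> e"
      using specification_periodic_shadowing[OF compact cont spec e(1)] by blast
    obtain K :: nat where K: "1 \<le> K" and pigeonhole:
      "\<And>(E :: 'a set) v. finite E \<Longrightarrow> (\<And>x. x \<in> E \<Longrightarrow> \<bar>v x\<bar> \<le> B) \<Longrightarrow>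
        \<exists>c E'. E' \<subseteq> E \<and> card E \<le> K * card E' \<and> (\<forall>x\<in>E'. c \<le> v x \<and> v x \<le> c + \<delta>)"
      using pigeonhole_real_valued[OF \<delta>(1)] by metis
    have gap0: "(\<lambda>n. real (L n) / real n) \<longlonglongrightarrow> 0" using L by (simp add: tempered_def)
    have ev_gap: "\<forall>\<^sub>F n in sequentially. real (L n) / real n * B < \<delta>"
      using \<delta>(1) by (intro order_tendstoD(2)[OF tendsto_mult_left_zero[OF gap0]])
    \<comment> \<open>The entropy per unit of time that survives the fixed segments, the thinning by
      \<open>K\<close> and the gaps.\<close>
    have "(\<lambda>n. real (q - 1) / real q * ((r - ln (real K) / real n) / (1 + real (L n) / real n)))
        \<longlonglongrightarrow> real (q - 1) / real q * ((r - 0) / (1 + 0))"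
      by (intro tendsto_intros gap0 lim_const_over_n) simp
    then have ev_rate: "\<forall>\<^sub>F n in sequentially. s < real (q - 1) / real q * ((r - ln (real K) / real n) / (1 + real (L n) / real n))"
      using qs by (intro order_tendstoD(1)) auto
    \<comment> \<open>A \<open>limsup\<close> yields many separated segments only for infinitely
      many \<open>n\<close>; the other requirements hold eventually, so some \<open>n\<close> meets
      them all.\<close>
    have "\<exists>\<^sub>F n in sequentially. ereal r < ereal (1 / real n * ln (real (max_separated_card f UNIV n (3 * \<epsilon>))))"
    proof (rule ccontr)
      assume "\<not> ?thesis"
      then have "\<forall>\<^sub>F n in sequentially. ereal (1 / real n * ln (real (max_separated_card f UNIV n (3 * \<epsilon>)))) \<le> ereal r"
        by (simp add: frequently_def not_less)
      then have "scale_entropy f UNIV (3 * \<epsilon>) \<le> ereal r"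
        unfolding scale_entropy_def by (rule Limsup_bounded)
      with r(2) show False by simp
    qed
    from frequently_eventually_conj[OF this eventually_conj[OF eventually_ge_at_top[of 1] eventually_conj[OF ev_gap ev_rate]]]
    obtain n where n: "1 \<le> n" and many: "r < 1 / real n * ln (real (max_separated_card f UNIV n (3 * \<epsilon>)))"
      and gap: "real (L n) / real n * B < \<delta>"
      and rate: "s < real (q - 1) / real q * ((r - ln (real K) / real n) / (1 + real (L n) / real n))"
      using frequently_ex by fastforce
    have gap': "real (L n) * B \<le> real n * \<delta>" using gap n by (simp add: field_simps)
    obtain E0 where E0: "finite E0" "bowen_separated f n (3 * \<epsilon>) E0" "card E0 = max_separated_card f UNIV n (3 * \<epsilon>)"
      using max_separated_card_attained[OF compact cont n] \<open>0 < \<epsilon>\<close> by (metis mult_pos_pos zero_less_numeral)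
    have "\<bar>birkhoff_sum f \<phi> n x / real n\<bar> \<le> B" for x
      using abs_birkhoff_sum_le[of \<phi> B f n x] B n by (simp add: field_simps)
    then obtain c E where E: "E \<subseteq> E0" "card E0 \<le> K * card E"
      and c: "\<And>x. x \<in> E \<Longrightarrow> c \<le> birkhoff_sum f \<phi> n x / real n \<and> birkhoff_sum f \<phi> n x / real n \<le> c + \<delta>"
      using pigeonhole[OF E0(1), of "\<lambda>x. birkhoff_sum f \<phi> n x / real n"] by blast
    have c': "real n * c \<le> birkhoff_sum f \<phi> n x \<and> birkhoff_sum f \<phi> n x \<le> real n * (c + \<delta>)" if "x \<in> E" for x
      using c[OF that] n by (simp add: field_simps)
    have "1 \<le> card E0"
      unfolding E0(3) using max_separated_card_ge_1[OF compact cont n] \<open>0 < \<epsilon>\<close> by simp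
    then have "1 \<le> card E" using E(2) by (cases "card E = 0") auto
    then have "finite E" "E \<noteq> {}" by (auto simp: card_gt_0_iff Suc_le_eq)
    have sepE: "bowen_separated f n (3 * \<epsilon>) E"
      using E0(2) E(1) by (auto simp: bowen_separated_def)
    define \<eta> where "\<eta> = ln (real (card E))"
    have \<eta>: "real n * r - ln (real K) \<le> \<eta>"
    proof -
      have "real n * r \<le> ln (real (card E0))"
        using many n unfolding E0(3) by (simp add: field_simps)
      also have "\<dots> \<le> ln (real (K * card E))"
        using E(2) K \<open>1 \<le> card E0\<close> \<open>1 \<le> card E\<close>
        by (subst ln_le_cancel_iff) (simp_all add: Suc_le_eq del: of_nat_mult)
      also have "\<dots> = ln (real K) + \<eta>"
        using K \<open>1 \<le> card E\<close> by (simp add: ln_mult \<eta>_def)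
      finally show ?thesis by simp
    qed
    have "0 \<le> \<eta>" using \<open>1 \<le> card E\<close> by (simp add: \<eta>_def)
    define P where "P = n + L n"
    have P: "n \<le> P" "0 < P" using n by (auto simp: P_def)
    \<comment> \<open>A cell of duration \<open>q * P\<close> carries \<open>q - 1\<close> free
      choices, each worth \<open>\<eta>\<close>.\<close>
    define \<kappa> where "\<kappa> = real (q - 1) * \<eta> / real (q * P)"
    have "s < \<kappa>"
    proof -
      have "(r - ln (real K) / real n) / (1 + real (L n) / real n) = (real n * r - ln (real K)) / real P"
      proof -
        have "r - ln (real K) / real n = (real n * r - ln (real K)) / real n"
          using n by (simp add: diff_divide_distrib)
        moreover have "1 + real (L n) / real n = real P / real n"
          using n by (simp add: P_def add_divide_distrib)
        ultimately show ?thesis using n by simp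
      qed
      then have "s < real (q - 1) / real q * ((real n * r - ln (real K)) / real P)"
        using rate by simp
      also have "\<dots> \<le> real (q - 1) / real q * (\<eta> / real P)"
        using \<eta> by (intro mult_left_mono divide_right_mono) auto
      finally show ?thesis by (simp add: \<kappa>_def)
    qed
    \<comment> \<open>Rounding down to whole cells loses at most \<open>(q - 1) * \<eta>\<close>,
      which the surplus \<open>(\<kappa> - s) * m\<close> covers once
      \<open>m \<ge> N\<close>.\<close>
    obtain N where N: "real (q - 1) * \<eta> / (\<kappa> - s) \<le> real N" using real_arch_simple by blast
    have growth: "s * real m \<le> real ((q - 1) * (m div (q * P))) * \<eta>" if "N \<le> m" for m
    proof -
      have "real (q - 1) * \<eta> / (\<kappa> - s) \<le> real m" using N that by simp
      then have "s * real m \<le> \<kappa> * real m - real (q - 1) * \<eta>"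
        using \<open>s < \<kappa>\<close> by (simp add: field_simps)
      also have "\<dots> = (real (q - 1) * \<eta>) * (real m / real (q * P) - 1)"
        by (simp add: \<kappa>_def algebra_simps)
      also have "\<dots> \<le> (real (q - 1) * \<eta>) * real (m div (q * P))"
      proof (rule mult_left_mono)
        show "real m / real (q * P) - 1 \<le> real (m div (q * P))"
          using floor_correct[of "real m / real (q * P)"]
          unfolding floor_divide_of_nat_eq of_int_of_nat_eq by linarith
      qed (use \<open>0 \<le> \<eta>\<close> in simp)
      finally show ?thesis by (simp add: mult_ac)
    qed
    obtain z\<^sub>1 z\<^sub>2 where z: "birkhoff_sum f \<phi> n z\<^sub>1 \<le> real n * \<alpha>" "real n * \<beta> \<le> birkhoff_sum f \<phi> n z\<^sub>2"
      using lows[OF n] highs[OF n] by blast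
    define x where "x \<omega> j = (if q dvd j then if even (floor_log (j div q)) then z\<^sub>1 else z\<^sub>2 else \<omega> j)" for \<omega> j
    have "\<forall>\<omega>. \<exists>y. \<forall>j. \<forall>i<n. dist ((f ^^ (j * P + i)) y) ((f ^^ i) (x \<omega> j)) \<le> e"
      unfolding P_def using shadowing[OF n] by blast
    then obtain Y where Y: "\<And>\<omega> j i. i < n \<Longrightarrow> dist ((f ^^ (j * P + i)) (Y \<omega>)) ((f ^^ i) (x \<omega> j)) \<le> e"
      by metis
    have "1 \<le> bowen_premeasure f (irregular_set f \<phi>) s N \<epsilon>"
    proof (rule bowen_premeasure_ge_1_if_coded[OF \<open>finite E\<close> \<open>E \<noteq> {}\<close> sepE n P(1) q1])
      show "s * real m \<le> real ((q - 1) * (m div (q * P))) * ln (real (card E))" if "N \<le> m" for m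
        using growth[OF that] by (simp add: \<eta>_def)
    next
      fix \<omega> :: "nat \<Rightarrow> 'a" and j i assume "\<not> q dvd j" "i < n"
      then show "dist ((f ^^ (j * P + i)) (Y \<omega>)) ((f ^^ i) (\<omega> j)) \<le> \<epsilon> / 2"
        using Y[of i j \<omega>] e(2) by (simp add: x_def)
    next
      fix \<omega> :: "nat \<Rightarrow> 'a" assume \<omega>: "\<omega> \<in> UNIV \<rightarrow> E"
      show "Y \<omega> \<in> irregular_set f \<phi>"
      proof (rule shadowing_point_irregular[where x = "x \<omega>" and c = c, OF Y[unfolded P_def] modulus B gap' n q1 \<delta>])
        fix j assume "\<not> q dvd j"
        then show "real n * c \<le> birkhoff_sum f \<phi> n (x \<omega> j) \<and> birkhoff_sum f \<phi> n (x \<omega> j) \<le> real n * (c + \<delta>)"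
          using c'[of "\<omega> j"] \<omega> by (simp add: x_def Pi_iff)
      qed (use z q1 in \<open>simp_all add: x_def\<close>)
    qed
    then show ?thesis unfolding s(1) by (rule le_bowen_entropyI)
  qed
qed

section \<open>Equality of the dimensions\<close>

theorem theorem1:
  fixes f :: "'a::metric_space \<Rightarrow> 'a" and \<phi> :: "'a \<Rightarrow> real"
  assumes "compact (UNIV :: 'a set)"
    and "continuous_on UNIV f"
    and "almost_weak_specification f"
    and "continuous_on UNIV \<phi>"
  shows "(upper_mdim f UNIV < \<infinity> \<longrightarrow>
           irregular_set f \<phi> = {} \<or> upper_bowen_mdim f (irregular_set f \<phi>) = upper_mdim f UNIV) \<and>
         (lower_mdim f UNIV < \<infinity> \<longrightarrow>
           irregular_set f \<phi> = {} \<or> lower_bowen_mdim f (irregular_set f \<phi>) = lower_mdim f UNIV)"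
proof (cases "irregular_set f \<phi> = {}")
  case False
  let ?F = "scale_entropy f UNIV" and ?H = "bowen_entropy f (irregular_set f \<phi>)"
  have lower: "?F (3 * \<epsilon>) \<le> ?H \<epsilon>" and upper: "?H (2 * \<epsilon>) \<le> ?F \<epsilon>" if "0 < \<epsilon>" for \<epsilon>
    using scale_entropy_le_bowen_entropy_irregular_set[OF assms False that]
      bowen_entropy_le_scale_entropy[OF assms(1,2) that] by auto
  have nonneg: "0 \<le> ?H \<epsilon>" "0 < \<epsilon> \<Longrightarrow> 0 \<le> ?F \<epsilon>" for \<epsilon>
    using bowen_entropy_nonneg[OF False] scale_entropy_nonneg[OF assms(1,2)] by auto
  have "upper_bowen_mdim f (irregular_set f \<phi>) = upper_mdim f UNIV"
    unfolding upper_bowen_mdim_def upper_mdim_def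
    by (intro antisym Limsup_ln_rescale_le[of 2 ?H ?F] Limsup_ln_rescale_le[of 3 ?F ?H] lower upper nonneg) auto
  moreover have "lower_bowen_mdim f (irregular_set f \<phi>) = lower_mdim f UNIV"
    unfolding lower_bowen_mdim_def lower_mdim_def
    by (intro antisym Liminf_ln_rescale_le[of 2 ?H ?F] Liminf_ln_rescale_le[of 3 ?F ?H] lower upper nonneg) auto
  ultimately show ?thesis by simp
qed simp

end
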